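(* The following algorithm (tropical point, zero-dimensional case only) terminates and is correct. Input: a triangular set $F=\{f_1,\dots,f_n\}\subseteq K[x_1,\dots,x_n]$ with $V(F)\subseteq (K^* )^n$. Output: a point $w\in\mathrm{Trop}(F)$. Steps: 1. Pick $w_1\in\Lambda(f_1)$. 2. For $i=2,\dots,n$ do: if $f_i$ has a unique Newton polygon at $(w_1,\dots,w_{i-1})$, pick $w_i\in\Lambda_{(w_1,\dots,w_{i-1})}(f_i)$; otherwise, compute a root $(z_1,\dots,z_{i-1})\in V(f_1,\dots,f_{i-1})$ and pick $w_i\in\Lambda(f_i(z_1,\dots,z_{i-1},x_i))$. 3. Return $(w_1,\dots,w_n)$.
   Context: $K$ is an algebraically closed field with non-trivial valuation $\nu:K\to\mathbb R\cup\{\infty\}$ with $1\in\nu(K^* )$, and $\mathfrak K$ is its residue field. Fix a homomorphism $\psi:(\nu(K^* ),+)\to(K^*,\cdot)$ with $\nu(\psi(w))=w$ and write $p^w:=\psi(w)$. For $w\in\mathbb R^n$ and $f=\sum_\alpha c_\alpha x^\alpha\in K[x_1,\dots,x_n]$ let $\mathrm{trop}(f)(w)=\min\{w\cdot\alpha+\nu(c_\alpha)\mid c_\alpha\ne0\}$ and $\mathrm{in}_w(f)=\sum_{w\cdot\alpha+\nu(c_\alpha)=\mathrm{trop}(f)(w)}\overline{c_\alpha p^{-\nu(c_\alpha)}}\,x^\alpha\in\mathfrak K[x]$. For an ideal $I$, $\mathrm{in}_w(I)=\langle \mathrm{in}_w(f)\mid f\in I\rangle$, and $\mathrm{Trop}(I)=\{w\in\mathbb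 R^n\mid \mathrm{in}_w(I)\text{ contains no monomial}\}$; equivalently, $\mathrm{Trop}(I)$ is the Euclidean closure of $\nu(V(I)\cap(K^* )^n)$ under component-wise valuation. For a finite set $F$ of polynomials, $\mathrm{Trop}(F):=\mathrm{Trop}(\langle F\rangle)$. A set $F=\{f_1,\dots,f_n\}$ is triangular if for each $k$ we have $f_k\in K[x_1,\dots,x_k]$ and $f_k=c_kx_k^{d_k}+(\text{terms of lower }x_k\text{-degree})$ with $c_k\in K^*$, $d_k\in\mathbb N_{>0}$. For a univariate $f=\sum_i c_ix_k^i\in K[x_k]$, the Newton polygon is $\Delta(f)=\mathrm{Conv}(\{(i,\nu(c_i))\mid c_i\neq0\})+(\{0\}\times\mathbb R_{\ge0})$. For $f=\sum_i f_ix_k^i\in K[x_1,\dots,x_k]$ with $f_i\in K[x_1,\dots,x_{k-1}]$ and $w\in\mathbb R^{k-1}$, the expected Newton polygon is $\Delta_w(f)=\mathrm{Conv}(\{(i,\mathrm{trop}(f_i)(w))\mid f_i\ne0\})+(\{0\}\times\mathbb R_{\ge0})$. $f$ has a unique Newton polygon at $w$ if $\mathrm{in}_w(f_i)$ is a monomial for every vertex $(i,\mathrm{trop}(f_i)(w))$ of $\Delta_w(f)$. $\Lambda(f)$ resp. $\Lambda_w(f)$ denotes the set of negatives of the slopes of $\Delta(f)$ resp. $\Delta_w(f)$.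
   Formalization: In step 2 the root (z_1,…,z_{i-1}) is required to satisfy ν(z_j)=w_j for all j<i; with an arbitrary root the claim fails, e.g. f_1=(x_1-1)(x_1-t), f_2=x_2+x_1-1+t^2 with ν(t)=1, w_1=0, z_1=t. *)

theory Defs
  imports
    "HOL-Analysis.Analysis"
    "HOL-Computational_Algebra.Polynomial"
    "HOL-Library.Poly_Mapping"
    "HOL-Library.Set_Algebras"
begin

text \<open>
  Polynomials in \<open>x\<^sub>1, \<dots>, x\<^sub>n\<close> are finitely supported maps from exponents to coefficients,
  with the convolution product of \<^theory>\<open>HOL-Library.Poly_Mapping\<close>.
  Variables are counted from 0: the number \<open>i\<close> stands for \<open>x\<^bsub>i+1\<^esub>\<close>.
  Points of \<open>\<real>\<^sup>n\<close> and \<open>K\<^sup>n\<close> are lists of length \<open>n\<close>.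
\<close>

type_synonym 'a mpoly = "(nat \<Rightarrow>\<^sub>0 nat) \<Rightarrow>\<^sub>0 'a"

abbreviation expo :: "(nat \<Rightarrow>\<^sub>0 nat) \<Rightarrow> nat \<Rightarrow> nat" where
  "expo \<equiv> Poly_Mapping.lookup"

abbreviation mcoeff :: "'a::zero mpoly \<Rightarrow> (nat \<Rightarrow>\<^sub>0 nat) \<Rightarrow> 'a" where
  "mcoeff \<equiv> Poly_Mapping.lookup"

abbreviation supp :: "'a::zero mpoly \<Rightarrow> (nat \<Rightarrow>\<^sub>0 nat) set" where
  "supp \<equiv> Poly_Mapping.keys"

definition mpolys :: "nat \<Rightarrow> 'a::zero mpoly set" where
  "mpolys n = {f. \<forall>\<alpha>\<in>supp f. Poly_Mapping.keys \<alpha> \<subseteq> {..<n}}"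

text \<open>A monomial may carry a coefficient. Over a field this makes no difference for the
  question whether an ideal contains a monomial.\<close>

definition is_monomial :: "'a::zero mpoly \<Rightarrow> bool" where
  "is_monomial f \<longleftrightarrow> (\<exists>\<alpha> c. c \<noteq> 0 \<and> f = Poly_Mapping.single \<alpha> c)"

definition eval_monomial :: "'a::comm_semiring_1 list \<Rightarrow> (nat \<Rightarrow>\<^sub>0 nat) \<Rightarrow> 'a" where
  "eval_monomial z \<alpha> = (\<Prod>j<length z. z ! j ^ expo \<alpha> j)"

definition eval_mpoly :: "'a::comm_semiring_1 mpoly \<Rightarrow> 'a list \<Rightarrow> 'a" where
  "eval_mpoly f z = (\<Sum>\<alpha>\<in>supp f. mcoeff f \<alpha> * eval_monomial z \<alpha>)"

definition variety :: "nat \<Rightarrow> 'a::comm_semiring_1 mpoly set \<Rightarrow> 'a list set" where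
  "variety n S = {z. length z = n \<and> (\<forall>f\<in>S. eval_mpoly f z = 0)}"

text \<open>The ideal of \<open>K[x\<^sub>1, \<dots>, x\<^sub>n]\<close> generated by \<open>S\<close>.\<close>

definition ideal_gen :: "nat \<Rightarrow> 'a::comm_ring_1 mpoly set \<Rightarrow> 'a mpoly set" where
  "ideal_gen n S =
     {\<Sum>f\<in>T. g f * f | T g. finite T \<and> T \<subseteq> S \<and> (\<forall>f\<in>T. g f \<in> mpolys n)}"

text \<open>For \<open>f \<in> K[x\<^sub>1, \<dots>, x\<^bsub>k+1\<^esub>]\<close>, the coefficient in \<open>K[x\<^sub>1, \<dots>, x\<^sub>k]\<close> of \<open>x\<^bsub>k+1\<^esub>\<^sup>i\<close>.\<close>

definition coeff_wrt :: "nat \<Rightarrow> 'a::comm_monoid_add mpoly \<Rightarrow> nat \<Rightarrow> 'a mpoly" where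
  "coeff_wrt k f i =
     (\<Sum>\<alpha>\<in>{\<alpha>\<in>supp f. expo \<alpha> k = i}. Poly_Mapping.single (Poly_Mapping.update k 0 \<alpha>) (mcoeff f \<alpha>))"

text \<open>For \<open>z \<in> K\<^sup>k\<close>, the univariate polynomial \<open>f(z\<^sub>1, \<dots>, z\<^sub>k, x\<^bsub>k+1\<^esub>)\<close>.\<close>

definition specialize :: "'a::comm_semiring_1 mpoly \<Rightarrow> 'a list \<Rightarrow> 'a poly" where
  "specialize f z =
     (\<Sum>\<alpha>\<in>supp f. Polynomial.monom (mcoeff f \<alpha> * eval_monomial z \<alpha>) (expo \<alpha> (length z)))"

definition triangular :: "'a::field mpoly list \<Rightarrow> bool" where
  "triangular fs \<longleftrightarrow>
     (\<forall>k<length fs. fs ! k \<in> mpolys (Suc k) \<and>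
        (\<exists>c d. c \<noteq> 0 \<and> d > 0 \<and>
           (\<forall>\<alpha>\<in>supp (fs ! k - Poly_Mapping.single (Poly_Mapping.single k d) c). expo \<alpha> k < d)))"

definition is_valuation :: "('a::field \<Rightarrow> ereal) \<Rightarrow> bool" where
  "is_valuation v \<longleftrightarrow>
     (\<forall>x. v x \<noteq> - \<infinity>) \<and>
     (\<forall>x. v x = \<infinity> \<longleftrightarrow> x = 0) \<and>
     (\<forall>x y. v (x * y) = v x + v y) \<and>
     (\<forall>x y. v (x + y) \<ge> min (v x) (v y))"

definition nontrivial_valuation :: "('a::field \<Rightarrow> ereal) \<Rightarrow> bool" where
  "nontrivial_valuation v \<longleftrightarrow> (\<exists>x. x \<noteq> 0 \<and> v x \<noteq> 0)"

text \<open>The real-valued form of the valuation; meaningful for nonzero arguments only.\<close>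

definition val :: "('a::field \<Rightarrow> ereal) \<Rightarrow> 'a \<Rightarrow> real" where
  "val v x = real_of_ereal (v x)"

definition value_group :: "('a::field \<Rightarrow> ereal) \<Rightarrow> real set" where
  "value_group v = {r. \<exists>x. x \<noteq> 0 \<and> v x = ereal r}"

text \<open>The homomorphism \<open>w \<mapsto> p\<^sup>w\<close>; its values outside the value group are irrelevant.\<close>

definition is_splitting :: "('a::field \<Rightarrow> ereal) \<Rightarrow> (real \<Rightarrow> 'a) \<Rightarrow> bool" where
  "is_splitting v psi \<longleftrightarrow>
     (\<forall>a\<in>value_group v. v (psi a) = ereal a) \<and>
     (\<forall>a\<in>value_group v. \<forall>b\<in>value_group v. psi (a + b) = psi a * psi b)"

text \<open>The residue field is given by its reduction map: a surjective ring homomorphism from the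
  valuation ring onto a field, whose kernel is the maximal ideal. Values outside the valuation
  ring are irrelevant.\<close>

definition is_residue_map :: "('a::field \<Rightarrow> ereal) \<Rightarrow> ('a \<Rightarrow> 'k::field) \<Rightarrow> bool" where
  "is_residue_map v res \<longleftrightarrow>
     res 1 = 1 \<and>
     (\<forall>x y. v x \<ge> 0 \<longrightarrow> v y \<ge> 0 \<longrightarrow> res (x + y) = res x + res y \<and> res (x * y) = res x * res y) \<and>
     res ` {x. v x \<ge> 0} = UNIV \<and>
     (\<forall>x. v x \<ge> 0 \<longrightarrow> (res x = 0 \<longleftrightarrow> v x > 0))"

definition dot :: "real list \<Rightarrow> (nat \<Rightarrow>\<^sub>0 nat) \<Rightarrow> real" where
  "dot w \<alpha> = (\<Sum>j<length w. w ! j * real (expo \<alpha> j))"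

text \<open>Meaningful for \<open>f \<noteq> 0\<close> only.\<close>

definition trop :: "('a::field \<Rightarrow> ereal) \<Rightarrow> 'a mpoly \<Rightarrow> real list \<Rightarrow> real" where
  "trop v f w = Min ((\<lambda>\<alpha>. dot w \<alpha> + val v (mcoeff f \<alpha>)) ` supp f)"

definition initial_form ::
    "('a::field \<Rightarrow> ereal) \<Rightarrow> (real \<Rightarrow> 'a) \<Rightarrow> ('a \<Rightarrow> 'k::field) \<Rightarrow> real list \<Rightarrow> 'a mpoly \<Rightarrow> 'k mpoly" where
  "initial_form v psi res w f =
     (\<Sum>\<alpha>\<in>{\<alpha>\<in>supp f. dot w \<alpha> + val v (mcoeff f \<alpha>) = trop v f w}.
        Poly_Mapping.single \<alpha> (res (mcoeff f \<alpha> * psi (- val v (mcoeff f \<alpha>)))))"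

definition initial_ideal ::
    "('a::field \<Rightarrow> ereal) \<Rightarrow> (real \<Rightarrow> 'a) \<Rightarrow> ('a \<Rightarrow> 'k::field) \<Rightarrow> nat \<Rightarrow> real list \<Rightarrow> 'a mpoly set
       \<Rightarrow> 'k mpoly set" where
  "initial_ideal v psi res n w I = ideal_gen n (initial_form v psi res w ` I)"

definition Trop ::
    "('a::field \<Rightarrow> ereal) \<Rightarrow> (real \<Rightarrow> 'a) \<Rightarrow> ('a \<Rightarrow> 'k::field) \<Rightarrow> nat \<Rightarrow> 'a mpoly set
       \<Rightarrow> real list set" where
  "Trop v psi res n I =
     {w. length w = n \<and> \<not> (\<exists>m\<in>initial_ideal v psi res n w I. is_monomial m)}"

definition newton_polygon :: "('a::field \<Rightarrow> ereal) \<Rightarrow> 'a poly \<Rightarrow> (real \<times> real) set" where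
  "newton_polygon v f =
     convex hull {(real i, val v (Polynomial.coeff f i)) | i. Polynomial.coeff f i \<noteq> 0} + ({0} \<times> {0..})"

text \<open>The polynomial is expanded with respect to the first variable not assigned by \<open>w\<close>.\<close>

definition expected_newton_polygon ::
    "('a::field \<Rightarrow> ereal) \<Rightarrow> real list \<Rightarrow> 'a mpoly \<Rightarrow> (real \<times> real) set" where
  "expected_newton_polygon v w f =
     convex hull {(real i, trop v (coeff_wrt (length w) f i) w) | i. coeff_wrt (length w) f i \<noteq> 0}
       + ({0} \<times> {0..})"

definition unique_newton_polygon ::
    "('a::field \<Rightarrow> ereal) \<Rightarrow> (real \<Rightarrow> 'a) \<Rightarrow> ('a \<Rightarrow> 'k::field) \<Rightarrow> real list \<Rightarrow> 'a mpoly \<Rightarrow> bool" where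
  "unique_newton_polygon v psi res w f \<longleftrightarrow>
     (\<forall>i. coeff_wrt (length w) f i \<noteq> 0 \<longrightarrow>
        (real i, trop v (coeff_wrt (length w) f i) w) extreme_point_of expected_newton_polygon v w f \<longrightarrow>
        is_monomial (initial_form v psi res w (coeff_wrt (length w) f i)))"

text \<open>Negatives of the slopes of the edges of a polygon in the plane. The vertical edges of a
  Newton polygon have no slope.\<close>

definition neg_slopes :: "(real \<times> real) set \<Rightarrow> real set" where
  "neg_slopes P =
     {- ((snd b - snd a) / (fst b - fst a)) | a b e.
        e edge_of P \<and> a \<in> e \<and> b \<in> e \<and> fst a \<noteq> fst b}"

text \<open>
  The algorithm as a nondeterministic transition system. In \<open>Looping w\<close> the coordinates \<open>w\<close> have
  been picked and the loop condition is checked next; in \<open>Rooted w z\<close> the root \<open>z\<close> has been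
  computed and the next coordinate has not yet been picked. The root has to lie over the
  coordinates picked so far: with a root of different valuation the result can be wrong.
\<close>

datatype 'a state = Init | Looping "real list" | Rooted "real list" "'a list" | Returned "real list"

inductive alg_step ::
    "('a::field \<Rightarrow> ereal) \<Rightarrow> (real \<Rightarrow> 'a) \<Rightarrow> ('a \<Rightarrow> 'k::field) \<Rightarrow> 'a mpoly list \<Rightarrow> 'a state \<Rightarrow> 'a state
       \<Rightarrow> bool"
  for v psi res fs where
  pick_first:
    "w \<in> neg_slopes (newton_polygon v (specialize (fs ! 0) [])) \<Longrightarrow>
     alg_step v psi res fs Init (Looping [w])"
| pick_expected:
    "length ws < length fs \<Longrightarrow>
     unique_newton_polygon v psi res ws (fs ! length ws) \<Longrightarrow>
     w \<in> neg_slopes (expected_newton_polygon v ws (fs ! length ws)) \<Longrightarrow>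
     alg_step v psi res fs (Looping ws) (Looping (ws @ [w]))"
| compute_root:
    "length ws < length fs \<Longrightarrow>
     \<not> unique_newton_polygon v psi res ws (fs ! length ws) \<Longrightarrow>
     z \<in> variety (length ws) (set (take (length ws) fs)) \<Longrightarrow>
     map v z = map ereal ws \<Longrightarrow>
     alg_step v psi res fs (Looping ws) (Rooted ws z)"
| pick_root:
    "w \<in> neg_slopes (newton_polygon v (specialize (fs ! length ws) z)) \<Longrightarrow>
     alg_step v psi res fs (Rooted ws z) (Looping (ws @ [w]))"
| return:
    "length ws = length fs \<Longrightarrow>
     alg_step v psi res fs (Looping ws) (Returned ws)"

end

theory Submission
  imports Defs
begin

text \<open>
  Every reachable tuple \<open>(w\<^sub>1, \<dots>, w\<^sub>i)\<close> is the valuation of a common root \<open>z\<close> of the first \<open>i\<close>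
  equations. By triangularity \<open>z\<close> extends to a point of \<open>V(F)\<close>, so the constant coefficient of
  \<open>f\<^bsub>i+1\<^esub>(z, x)\<close> does not vanish and all Newton polygons in question have an edge with a slope.
  A negated slope \<open>w\<close> is a value for which the minimum of \<open>\<nu>(c\<^sub>k) + w k\<close> over the coefficients \<open>c\<^sub>k\<close> of
  \<open>f\<^bsub>i+1\<^esub>(z, x)\<close> is attained at the two end vertices of an edge: in the case of a unique Newton
  polygon, the coefficients at the vertices of the expected polygon have the expected valuation at
  \<open>z\<close>, and all the others have at least that. Comparing with the factorization into linear factors,
  there is a root of valuation \<open>w\<close>, so that the invariant persists.
  Finally, a root \<open>z\<close> of \<open>F\<close> with valuation \<open>w\<close> reduces to the point with coordinates the residues of
  \<open>z\<^sub>j \<psi>(-w\<^sub>j)\<close>, at which all initial forms vanish but no monomial does.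
\<close>

section \<open>Upper hulls in the plane\<close>

text \<open>The shape shared by Newton polygons and expected Newton polygons, so that both are
  treated at once.\<close>

definition upper_hull :: "(real \<times> real) set \<Rightarrow> (real \<times> real) set" where
  "upper_hull S = convex hull S + ({0} \<times> {0..})"

lemma upper_hull_memI: "p \<in> convex hull S \<Longrightarrow> t \<ge> 0 \<Longrightarrow> (fst p, snd p + t) \<in> upper_hull S"
  unfolding upper_hull_def by (rule set_plus_intro[where b = "(0, t)", THEN back_subst[where P = "\<lambda>q. q \<in> _"]]) (auto simp: plus_prod_def)

lemma subset_upper_hull: "S \<subseteq> upper_hull S"
  using upper_hull_memI[of _ S 0] by (auto intro: hull_inc)

lemma convex_upper_hull: "convex (upper_hull S)"
  unfolding upper_hull_def by (intro convex_set_plus convex_convex_hull convex_Times) auto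

lemma upper_hull_upward: "p \<in> upper_hull S \<Longrightarrow> t \<ge> 0 \<Longrightarrow> (fst p, snd p + t) \<in> upper_hull S"
proof -
  assume p: "p \<in> upper_hull S" and t: "t \<ge> 0"
  then obtain q s where "q \<in> convex hull S" "s \<ge> 0" "p = q + (0, s)"
    unfolding upper_hull_def by (auto elim!: set_plus_elim)
  then show ?thesis using upper_hull_memI[of q S "s + t"] t
    by (simp add: plus_prod_def add.assoc)
qed

text \<open>Reduces a bound on the whole hull to a check on \<open>S\<close>, as soon as the
  bounding set is convex and closed upwards.\<close>

lemma upper_hull_subset:
  assumes "S \<subseteq> H" "convex H" "\<And>x y t. (x, y) \<in> H \<Longrightarrow> t \<ge> 0 \<Longrightarrow> (x, y + t) \<in> H"
  shows "upper_hull S \<subseteq> H"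
proof -
  have "convex hull S \<subseteq> H" using assms(1,2) by (rule hull_minimal)
  then show ?thesis
    unfolding upper_hull_def by (force elim!: set_plus_elim intro: assms(3))
qed

lemma upper_hull_above_line:
  fixes w m :: real
  assumes "\<And>x y. (x, y) \<in> S \<Longrightarrow> m \<le> y + w * x" and "p \<in> upper_hull S"
  shows "m \<le> snd p + w * fst p"
proof -
  have eq: "{p::real \<times> real. m \<le> snd p + w * fst p} = {p. inner (w, 1) p \<ge> m}"
    by (auto simp: inner_prod_def algebra_simps)
  have "convex {p::real \<times> real. m \<le> snd p + w * fst p}"
    unfolding eq by (rule convex_halfspace_ge)
  then have "upper_hull S \<subseteq> {p. m \<le> snd p + w * fst p}"
    using assms(1) by (intro upper_hull_subset) force+
  then show ?thesis using assms(2) by auto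
qed

text \<open>Taking \<open>e = 1\<close> and \<open>e = -1\<close> bounds the points on a supporting
  line from the left and from the right by one argument.\<close>

lemma upper_hull_on_line:
  fixes w m c e :: real
  assumes S: "\<And>x y. (x, y) \<in> S \<Longrightarrow> m < y + w * x \<or> m = y + w * x \<and> e * c \<le> e * x"
    and p: "p \<in> upper_hull S" and eq: "snd p + w * fst p = m"
  shows "e * c \<le> e * fst p"
proof -
  \<comment> \<open>A lexicographic half-plane: convex and closed upwards, although not topologically closed.\<close>
  define H where "H = {p::real \<times> real. m < snd p + w * fst p \<or> m = snd p + w * fst p \<and> e * c \<le> e * fst p}"
  have "convex H"
  proof (rule convexI)
    fix p q :: "real \<times> real" and s t :: real
    assume p: "p \<in> H" and q: "q \<in> H" and st: "0 \<le> s" "0 \<le> t" "s + t = 1"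
    obtain x y x' y' where xy: "p = (x, y)" "q = (x', y')" by (cases p, cases q)
    have t: "t = 1 - s" using st by simp
    show "s *\<^sub>R p + t *\<^sub>R q \<in> H"
    proof (cases "s = 0 \<or> t = 0")
      case True
      then show ?thesis using p q t by auto
    next
      case False
      then have pos: "s > 0" "t > 0" using st by auto
      define g where "g = y + w * x - m"
      define g' where "g' = y' + w * x' - m"
      have g: "g > 0 \<or> g = 0 \<and> e * c \<le> e * x" "g' > 0 \<or> g' = 0 \<and> e * c \<le> e * x'"
        using p q by (auto simp: H_def xy g_def g'_def)
      have val: "(s * y + t * y') + w * (s * x + t * x') - m = s * g + t * g'"
        unfolding g_def g'_def t by (simp add: algebra_simps)
      \<comment> \<open>A positive gap at either point makes the combined gap positive; otherwise
        both points lie on the line and the comparison along it decides.\<close>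
      consider "s * g + t * g' > 0" | "g = 0" "g' = 0" "e * c \<le> e * x" "e * c \<le> e * x'"
        using g pos by (metis add_nonneg_pos add_pos_nonneg less_eq_real_def mult_pos_pos mult_zero_right)
      then show ?thesis
      proof cases
        case 1
        then show ?thesis using val by (simp add: H_def xy)
      next
        case 2
        have "s * (e * c) + t * (e * c) \<le> s * (e * x) + t * (e * x')"
          using mult_left_mono[OF 2(3), of s] mult_left_mono[OF 2(4), of t] pos by linarith
        then have "e * c \<le> e * (s * x + t * x')"
          unfolding t by (simp add: algebra_simps)
        then show ?thesis using val 2 by (simp add: H_def xy)
      qed
    qed
  qed
  then have "upper_hull S \<subseteq> H"
    using S by (intro upper_hull_subset) (force simp: H_def)+
  then show ?thesis using p eq by (auto simp: H_def)
qed

text \<open>Both ends of a segment through the point must lie on the supporting line. There the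
  point minimizes \<open>e * x\<close>, so both ends coincide with it.\<close>

lemma extreme_point_of_upper_hull:
  fixes w m e x0 :: real
  assumes S: "\<And>x y. (x, y) \<in> S \<Longrightarrow> m < y + w * x \<or> m = y + w * x \<and> e * x0 \<le> e * x"
    and e: "e \<noteq> 0" and p: "(x0, y0) \<in> S" "m = y0 + w * x0"
  shows "(x0, y0) extreme_point_of upper_hull S"
  unfolding extreme_point_of_def
proof (intro conjI ballI notI)
  show "(x0, y0) \<in> upper_hull S" using p subset_upper_hull by auto
next
  fix a b assume a: "a \<in> upper_hull S" and b: "b \<in> upper_hull S" and seg: "(x0, y0) \<in> open_segment a b"
  have le: "m \<le> snd a + w * fst a" "m \<le> snd b + w * fst b"
    using S a b by (intro upper_hull_above_line[of S]; fastforce)+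
  from seg obtain u where ne: "a \<noteq> b" and u: "0 < u" "u < 1" "(x0, y0) = (1 - u) *\<^sub>R a + u *\<^sub>R b"
    by (auto simp: in_segment)
  obtain xa ya xb yb where ab: "a = (xa, ya)" "b = (xb, yb)" by (cases a, cases b)
  have x0: "x0 = (1 - u) * xa + u * xb" and y0: "y0 = (1 - u) * ya + u * yb"
    using u(3) by (auto simp: ab)
  have sum0: "(1 - u) * (ya + w * xa - m) + u * (yb + w * xb - m) = 0"
    using p(2) unfolding x0 y0 by (simp add: algebra_simps)
  have "(1 - u) * (ya + w * xa - m) \<ge> 0" "u * (yb + w * xb - m) \<ge> 0"
    using le u by (auto simp: ab)
  with sum0 have "(1 - u) * (ya + w * xa - m) = 0" "u * (yb + w * xb - m) = 0" by linarith+
  then have on: "ya + w * xa = m" "yb + w * xb = m" using u by auto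
  have "e * x0 \<le> e * xa" "e * x0 \<le> e * xb"
    using upper_hull_on_line[OF S a] upper_hull_on_line[OF S b] on by (auto simp: ab)
  moreover have "(1 - u) * (e * xa - e * x0) + u * (e * xb - e * x0) = 0"
    unfolding x0 by (simp add: algebra_simps)
  moreover have "(1 - u) * (e * xa - e * x0) \<ge> 0" "u * (e * xb - e * x0) \<ge> 0"
    using calculation(1,2) u by auto
  ultimately have "(1 - u) * (e * xa - e * x0) = 0" "u * (e * xb - e * x0) = 0" by linarith+
  then have "xa = x0" "xb = x0" using u e by auto
  with on ne show False by (simp add: ab)
qed

text \<open>An arbitrary face need not be exposed; for edges of an upper hull that are not vertical,
  the line through the edge supports the whole set.\<close>

lemma edge_of_upper_hull_supporting:
  assumes edge: "E edge_of upper_hull S" and a: "a \<in> E" and b: "b \<in> E" and ab: "fst a < fst b"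
    and w: "w = - ((snd b - snd a) / (fst b - fst a))" and q: "q \<in> upper_hull S"
  shows "snd a + w * fst a \<le> snd q + w * fst q"
proof (rule ccontr)
  assume below: "\<not> ?thesis"
  have face: "E face_of upper_hull S" and dim: "aff_dim E = 1"
    using edge by (auto simp: edge_of_def)
  obtain x1 y1 x2 y2 x y where xy: "a = (x1, y1)" "b = (x2, y2)" "q = (x, y)"
    by (cases a, cases b, cases q)
  have lt: "x1 < x2" using ab by (simp add: xy)
  have w': "w * (x2 - x1) = - (y2 - y1)" using w lt by (simp add: xy)
  define h where "h = y1 + w * x1 - (y + w * x)"
  have h: "h > 0" using below by (simp add: xy h_def)
  define cx where "cx = (x1 + x2) / 2"
  define cy where "cy = (y1 + y2) / 2"
  have c_in_E: "(cx, cy) \<in> E"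
  proof -
    have "(1/2) *\<^sub>R a + (1/2) *\<^sub>R b \<in> E"
      using face_of_imp_convex[OF face] a b by (intro convexD) auto
    then show ?thesis by (simp add: xy cx_def cy_def add_divide_distrib)
  qed
  \<comment> \<open>The factor is small enough to keep the abscissa of the prolonged point within
    the edge; the summand 1 in the denominator covers \<open>cx = x\<close>.\<close>
  obtain s where s: "s > 0" "s * \<bar>cx - x\<bar> \<le> (x2 - x1) / 2"
  proof
    show "(x2 - x1) / 2 / (\<bar>cx - x\<bar> + 1) > 0" using lt by (intro divide_pos_pos) auto
    have "\<bar>cx - x\<bar> / (\<bar>cx - x\<bar> + 1) \<le> 1" by simp
    then show "(x2 - x1) / 2 / (\<bar>cx - x\<bar> + 1) * \<bar>cx - x\<bar> \<le> (x2 - x1) / 2"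
      using lt mult_left_mono[of _ 1 "(x2 - x1) / 2"] by fastforce
  qed
  \<comment> \<open>The segment from \<open>q\<close> to the midpoint is prolonged beyond the
    midpoint by the factor \<open>s\<close>.\<close>
  define qx where "qx = cx + s * (cx - x)"
  define qy where "qy = cy + s * (cy - y)"
  have qx: "x1 \<le> qx" "qx \<le> x2"
  proof -
    have "\<bar>s * (cx - x)\<bar> \<le> (x2 - x1) / 2" using s by (simp add: abs_mult)
    moreover have "x1 = cx - (x2 - x1) / 2" "x2 = cx + (x2 - x1) / 2"
      by (auto simp: cx_def field_simps)
    ultimately show "x1 \<le> qx" "qx \<le> x2" unfolding qx_def by linarith+
  qed
  have line_c: "cy + w * cx = y1 + w * x1" 
    using w' unfolding cx_def cy_def by (simp add: field_simps)
  \<comment> \<open>The prolonged point lies exactly \<open>s * h\<close> above the point of the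
    edge with the same abscissa.\<close>
  have q': "(qx, qy) \<in> upper_hull S"
  proof -
    define u where "u = (qx - x1) / (x2 - x1)"
    have u: "0 \<le> u" "u \<le> 1" using qx lt by (auto simp: u_def)
    have "(1 - u) *\<^sub>R a + u *\<^sub>R b \<in> E"
      using face_of_imp_convex[OF face] a b u by (intro convexD) auto
    then have *: "(1 - u) *\<^sub>R a + u *\<^sub>R b \<in> upper_hull S"
      using face_of_imp_subset[OF face] by blast
    have ux: "u * (x2 - x1) = qx - x1" using lt by (simp add: u_def)
    have fx: "(1 - u) * x1 + u * x2 = qx" using ux by (simp add: algebra_simps)
    have "w * (u * (x2 - x1)) = - (u * (y2 - y1))" using w' by (metis mult.left_commute mult_minus_right)
    then have fy: "(1 - u) * y1 + u * y2 = y1 + w * x1 - w * qx"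
      unfolding ux by (simp add: algebra_simps)
    have "qy + w * qx = (cy + w * cx) + s * ((cy + w * cx) - (y + w * x))"
      unfolding qx_def qy_def by (simp add: algebra_simps)
    then have qy: "qy = y1 + w * x1 - w * qx + s * h"
      unfolding line_c h_def by simp
    from upper_hull_upward[OF *, of "s * h"] s h show ?thesis
      by (simp add: xy fx fy qy)
  qed
  \<comment> \<open>The midpoint \<open>(cx, cy)\<close> of the edge lies between a point \<open>q\<close> below its line and a point
    \<open>(qx, qy)\<close> above it, so the face property forces \<open>q\<close> into the one-dimensional edge.\<close>
  have "(cx, cy) \<in> open_segment q (qx, qy)"
  proof -
    have "q \<noteq> (qx, qy)"
    proof
      assume "q = (qx, qy)"
      then have "(1 + s) * (cx - x) = 0" "(1 + s) * (cy - y) = 0"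
        by (auto simp: xy qx_def qy_def algebra_simps)
      then have "cx = x" "cy = y" using s by auto
      then show False using line_c h by (simp add: h_def)
    qed
    moreover have "1 / (1 + s) * qx = cx - x * s / (1+s)" "1 / (1 + s) * qy = cy - y * s / (1+s)"
      using s by (auto simp: qx_def qy_def field_simps)
    moreover have "1 - 1 / (1 + s) = s / (1 + s)" using s by (simp add: field_simps)
    ultimately show ?thesis using s
      by (auto simp: in_segment xy intro!: exI[of _ "1 / (1 + s)"])
  qed
  then have "q \<in> E" using face_ofD[OF face _ q q'] c_in_E by blast
  \<comment> \<open>Collinearity makes the determinant of \<open>q\<close>, \<open>a\<close>,
    \<open>b\<close> vanish, but it equals \<open>(x2 - x1) * h\<close>, which is positive.\<close>
  then have "collinear {q, a, b}"
    using a b dim aff_dim_subset[of "{q, a, b}" E] by (simp add: collinear_aff_dim)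
  then obtain d where d: "\<And>r t. r \<in> {q,a,b} \<Longrightarrow> t \<in> {q,a,b} \<Longrightarrow> \<exists>k. r - t = k *\<^sub>R d"
    unfolding collinear_def by blast
  obtain k l where "q - a = k *\<^sub>R d" "b - a = l *\<^sub>R d" using d by (metis insertI1 insertI2)
  then have "(x - x1) = k * fst d" "(y - y1) = k * snd d" "x2 - x1 = l * fst d" "y2 - y1 = l * snd d"
    by (auto simp: xy prod_eq_iff)
  then have "(x - x1) * (y2 - y1) = (y - y1) * (x2 - x1)" by simp
  moreover have "(x2 - x1) * h = (x2 - x1) * y1 + (w * (x2 - x1)) * (x1 - x) - (x2 - x1) * y"
    unfolding h_def by (simp add: algebra_simps)
  ultimately have "(x2 - x1) * h = 0"
    unfolding w' by (simp add: algebra_simps)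
  then show False using h lt by simp
qed

text \<open>The line through the edge supports the hull; the leftmost and rightmost graph points on
  it serve as \<open>i\<close> and \<open>j\<close>. Their extremality makes the uniqueness
  condition on expected polygons applicable.\<close>

lemma neg_slopes_upper_hull_graph:
  fixes A :: "nat \<Rightarrow> bool" and y :: "nat \<Rightarrow> real"
  defines "S \<equiv> {(real i, y i) | i. A i}"
  assumes fin: "finite {i. A i}" and w: "w \<in> neg_slopes (upper_hull S)"
  shows "\<exists>i j m. i < j \<and> A i \<and> A j \<and> y i = m - w * real i \<and> y j = m - w * real j \<and>
    (\<forall>k. A k \<longrightarrow> m - w * real k \<le> y k) \<and>
    (real i, y i) extreme_point_of upper_hull S \<and> (real j, y j) extreme_point_of upper_hull S"
proof -
  \<comment> \<open>The slope is symmetric in the two points, so they may be ordered by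
    abscissa.\<close>
  obtain a b E where E: "E edge_of upper_hull S" "a \<in> E" "b \<in> E" "fst a < fst b"
    "w = - ((snd b - snd a) / (fst b - fst a))"
  proof -
    from w obtain a b E where *: "E edge_of upper_hull S" "a \<in> E" "b \<in> E" "fst a \<noteq> fst b"
      "w = - ((snd b - snd a) / (fst b - fst a))"
      unfolding neg_slopes_def by blast
    have "w = - ((snd a - snd b) / (fst a - fst b))"
      using *(5) by (metis minus_diff_eq minus_divide_divide)
    then show ?thesis using * that[of E a b] that[of E b a] by (meson linorder_neqE)
  qed
  define m where "m = snd a + w * fst a"
  note supp = edge_of_upper_hull_supporting[OF E, folded m_def]
  have ab: "a \<in> upper_hull S" "b \<in> upper_hull S"
    using E edge_of_imp_subset by blast+
  have mb: "snd b + w * fst b = m"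
    using E(4) unfolding m_def E(5) by (simp add: field_simps)
  have ge: "m \<le> y k + w * real k" if "A k" for k
    using supp[of "(real k, y k)"] subset_upper_hull[of S] that by (auto simp: S_def)
  define M where "M = {k. A k \<and> y k + w * real k = m}"
  have finM: "finite M" using fin by (simp add: M_def)
  \<comment> \<open>If the line missed the finite graph, the line raised by the least gap
    \<open>g\<close> would still bound the hull from below, although \<open>b\<close> lies on the
    original line.\<close>
  have "M \<noteq> {}"
  proof
    assume emp: "M = {}"
    have gt: "y k + w * real k - m > 0" if "A k" for k
      using emp ge[OF that] that by (force simp: M_def)
    have "upper_hull S \<noteq> {}" using ab by auto
    then have "{i. A i} \<noteq> {}" by (auto simp: S_def upper_hull_def)
    define g where "g = Min ((\<lambda>k. y k + w * real k - m) ` {i. A i})"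
    have "g > 0" unfolding g_def using fin gt \<open>{i. A i} \<noteq> {}\<close> by (subst Min_gr_iff) auto
    have "m + g \<le> y k + w * real k" if "A k" for k
    proof -
      have "g \<le> y k + w * real k - m" unfolding g_def using fin that by (intro Min_le) auto
      then show ?thesis by simp
    qed
    then have "m + g \<le> snd b + w * fst b"
      by (intro upper_hull_above_line[OF _ ab(2)]) (auto simp: S_def)
    with mb \<open>g > 0\<close> show False by simp
  qed
  define i where "i = Min M"
  define j where "j = Max M"
  have iM: "i \<in> M" and jM: "j \<in> M" using finM \<open>M \<noteq> {}\<close> by (auto simp: i_def j_def)
  have i_le: "i \<le> k" and j_ge: "k \<le> j" if "k \<in> M" for k
    using finM that by (auto simp: i_def j_def)
  \<comment> \<open>The two lexicographic bounds place the abscissas of \<open>a\<close> and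
    \<open>b\<close> between \<open>i\<close> and \<open>j\<close>; as they differ,
    \<open>i < j\<close>.\<close>
  have Si: "m < q + w * x \<or> m = q + w * x \<and> 1 * real i \<le> 1 * x" if "(x, q) \<in> S" for x q
    using that ge i_le unfolding S_def M_def by force
  have Sj: "m < q + w * x \<or> m = q + w * x \<and> (-1) * real j \<le> (-1) * x" if "(x, q) \<in> S" for x q
    using that ge j_ge unfolding S_def M_def by force
  have "real i \<le> fst a" using upper_hull_on_line[OF Si ab(1)] by (simp add: m_def)
  moreover have "fst b \<le> real j" using upper_hull_on_line[OF Sj ab(2)] mb by simp
  ultimately have "i < j" using E(4) by linarith
  moreover have "(real i, y i) extreme_point_of upper_hull S"
    using iM by (intro extreme_point_of_upper_hull[OF Si]) (auto simp: S_def M_def)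
  moreover have "(real j, y j) extreme_point_of upper_hull S"
    using jM by (intro extreme_point_of_upper_hull[OF Sj]) (auto simp: S_def M_def)
  moreover have "y i = m - w * real i" "y j = m - w * real j" "A i" "A j"
    using iM jM by (auto simp: M_def)
  moreover have "m - w * real k \<le> y k" if "A k" for k
    using ge[OF that] by simp
  ultimately show ?thesis by blast
qed

text \<open>One gift-wrapping step: from the leftmost graph point, the segment of least slope spans
  a supporting line. The face it cuts out lies in a line and contains two distinct points, so it is
  an edge.\<close>

lemma neg_slopes_upper_hull_nonempty:
  fixes A :: "nat \<Rightarrow> bool" and y :: "nat \<Rightarrow> real"
  defines "S \<equiv> {(real i, y i) | i. A i}"
  assumes fin: "finite {i. A i}" and ij: "A i" "A j" "i \<noteq> j"
  shows "neg_slopes (upper_hull S) \<noteq> {}"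
proof -
  define i0 where "i0 = Min {i. A i}"
  have i0: "A i0" and i0_le: "i0 \<le> k" if "A k" for k
    using fin ij that Min_in[of "{i. A i}"] by (auto simp: i0_def)
  define B where "B = {k. A k \<and> k \<noteq> i0}"
  have B: "finite B" "B \<noteq> {}" using fin ij by (auto simp: B_def)
  define slope where "slope k = (y k - y i0) / (real k - real i0)" for k
  obtain k1 where k1: "k1 \<in> B" "\<And>k. k \<in> B \<Longrightarrow> slope k1 \<le> slope k"
    using arg_min_if_finite[OF B, of slope] by (metis not_le)
  define w where "w = - slope k1"
  define m where "m = y i0 + w * real i0"
  have gt: "real i0 < real k" if "k \<in> B" for k
    using i0_le[of k] that by (force simp: B_def)
  have k1_eq: "y k1 + w * real k1 = m"
    using gt[OF k1(1)] unfolding m_def w_def slope_def by (simp add: field_simps)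
  have ge: "m \<le> y k + w * real k" if "A k" for k
  proof (cases "k = i0")
    case False
    then have "k \<in> B" using that by (simp add: B_def)
    then have "slope k1 * (real k - real i0) \<le> slope k * (real k - real i0)"
      using k1(2)[of k] gt[of k] by (intro mult_right_mono) auto
    also have "\<dots> = y k - y i0" using gt[OF \<open>k \<in> B\<close>] by (simp add: slope_def)
    finally show ?thesis unfolding m_def w_def by (simp add: algebra_simps)
  qed (simp add: m_def)
  let ?n = "(w, 1) :: real \<times> real"
  let ?F = "upper_hull S \<inter> {p. inner ?n p = m}"
  have above: "inner ?n p \<ge> m" if "p \<in> upper_hull S" for p
  proof -
    have "m \<le> snd p + w * fst p"
      using ge by (intro upper_hull_above_line[OF _ that]) (auto simp: S_def)
    then show ?thesis by (simp add: inner_prod_def)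
  qed
  have "?F face_of upper_hull S"
    by (rule face_of_Int_supporting_hyperplane_ge[OF convex_upper_hull above])
  moreover have pts: "(real i0, y i0) \<in> ?F" "(real k1, y k1) \<in> ?F"
    using i0[OF ij(1)] k1 k1_eq subset_upper_hull[of S]
    by (auto simp: S_def B_def inner_prod_def m_def algebra_simps)
  have "aff_dim ?F = 1"
  proof (rule antisym)
    have "?n \<noteq> 0" by (simp add: zero_prod_def)
    then have "aff_dim {p. inner ?n p = m} = 1"
      by (subst aff_dim_hyperplane) (auto simp: zero_prod_def)
    then show "aff_dim ?F \<le> 1" using aff_dim_subset[of ?F "{p. inner ?n p = m}"] by simp
    have "aff_dim {(real i0, y i0), (real k1, y k1)} = 1" using k1 by (simp add: B_def)
    then show "1 \<le> aff_dim ?F"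
      using aff_dim_subset[of "{(real i0, y i0), (real k1, y k1)}" ?F] pts by simp
  qed
  ultimately have "?F edge_of upper_hull S" by (simp add: edge_of_def)
  moreover have "fst (real i0, y i0) \<noteq> fst (real k1, y k1)" using gt[OF k1(1)] by simp
  ultimately show ?thesis using pts unfolding neg_slopes_def by blast
qed

section \<open>Evaluation of polynomials and triangular sets\<close>

text \<open>Cancellation may shrink the support of \<open>f + g\<close>, so all sums are first
  extended to the union of the supports. The general \<open>F\<close> serves both evaluation and
  specialization.\<close>

lemma sum_keys_add:
  assumes "\<And>\<alpha>. F \<alpha> 0 = 0" "\<And>\<alpha> a b. F \<alpha> (a + b) = F \<alpha> a + F \<alpha> b"
  shows "(\<Sum>\<alpha>\<in>Poly_Mapping.keys (f + g). F \<alpha> (Poly_Mapping.lookup (f + g) \<alpha>)) =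
    (\<Sum>\<alpha>\<in>Poly_Mapping.keys f. F \<alpha> (Poly_Mapping.lookup f \<alpha>)) +
    (\<Sum>\<alpha>\<in>Poly_Mapping.keys g. F \<alpha> (Poly_Mapping.lookup g \<alpha>) :: 'b::comm_monoid_add)"
proof -
  let ?U = "Poly_Mapping.keys f \<union> Poly_Mapping.keys g"
  have keys: "Poly_Mapping.keys (f + g) \<subseteq> ?U" by (rule keys_add)
  have ext: "(\<Sum>\<alpha>\<in>Poly_Mapping.keys h. F \<alpha> (Poly_Mapping.lookup h \<alpha>)) = (\<Sum>\<alpha>\<in>?U. F \<alpha> (Poly_Mapping.lookup h \<alpha>))"
    if "Poly_Mapping.keys h \<subseteq> ?U" for h
    using that by (intro sum.mono_neutral_left) (auto simp: assms(1) in_keys_iff)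
  show ?thesis
    unfolding ext[OF keys] ext[OF Un_upper1] ext[OF Un_upper2]
    by (simp add: lookup_add assms(2) sum.distrib)
qed

lemma eval_mpoly_0 [simp]: "eval_mpoly 0 z = 0"
  by (simp add: eval_mpoly_def)

lemma eval_mpoly_add: "eval_mpoly (f + g) z = eval_mpoly f z + eval_mpoly g z"
  unfolding eval_mpoly_def by (rule sum_keys_add) (auto simp: distrib_right)

lemma eval_mpoly_sum: "eval_mpoly (\<Sum>i\<in>I. f i) z = (\<Sum>i\<in>I. eval_mpoly (f i) z)"
  by (induction I rule: infinite_finite_induct) (auto simp: eval_mpoly_add)

lemma eval_mpoly_single: "eval_mpoly (Poly_Mapping.single \<alpha> c) z = c * eval_monomial z \<alpha>"
  by (simp add: eval_mpoly_def)

lemma eval_monomial_add: "eval_monomial z (\<alpha> + \<beta>) = eval_monomial z \<alpha> * eval_monomial z \<beta>"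
  by (simp add: eval_monomial_def lookup_add power_add prod.distrib)

lemma mpoly_eq_sum_single: "f = (\<Sum>\<alpha>\<in>supp f. Poly_Mapping.single \<alpha> (mcoeff f \<alpha>))"
  by (rule poly_mapping_eqI) (simp add: lookup_sum lookup_single when_def sum.delta' in_keys_iff)

lemma eval_mpoly_mult: "eval_mpoly (f * g) z = eval_mpoly f z * eval_mpoly g z"
proof -
  have "f * g = (\<Sum>\<alpha>\<in>supp f. \<Sum>\<beta>\<in>supp g.
      Poly_Mapping.single (\<alpha> + \<beta>) (mcoeff f \<alpha> * mcoeff g \<beta>))"
    by (subst mpoly_eq_sum_single[of f], subst mpoly_eq_sum_single[of g])
      (simp only: sum_product mult_single)
  then show ?thesis
    by (simp add: eval_mpoly_sum eval_mpoly_single eval_monomial_add eval_mpoly_def[of f]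
        eval_mpoly_def[of g] sum_product mult_ac)
qed

lemma eval_mpoly_ideal_gen:
  assumes "f \<in> ideal_gen n S" "\<And>g. g \<in> S \<Longrightarrow> eval_mpoly g z = 0"
  shows "eval_mpoly f z = 0"
  using assms by (force simp: ideal_gen_def eval_mpoly_sum eval_mpoly_mult intro!: sum.neutral)

lemma eval_mpoly_is_monomial:
  fixes z :: "'a::idom list"
  assumes "is_monomial f" "0 \<notin> set z"
  shows "eval_mpoly f z \<noteq> 0"
proof -
  obtain \<alpha> c where "c \<noteq> 0" "f = Poly_Mapping.single \<alpha> c" using assms(1) by (auto simp: is_monomial_def)
  moreover have "eval_monomial z \<alpha> \<noteq> 0"
    using assms(2) by (auto simp: eval_monomial_def in_set_conv_nth)
  ultimately show ?thesis by (simp add: eval_mpoly_single)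
qed

section \<open>Appending a coordinate and specializing the first variables\<close>

lemma eval_monomial_append:
  "eval_monomial (z @ [x]) \<alpha> = eval_monomial z \<alpha> * x ^ expo \<alpha> (length z)"
  by (simp add: eval_monomial_def nth_append)

lemma eval_mpoly_append_eq_poly: "eval_mpoly f (z @ [x]) = poly (specialize f z) x"
  by (simp add: eval_mpoly_def specialize_def poly_sum poly_monom eval_monomial_append mult.assoc)

lemma eval_mpoly_append_of_mpolys:
  assumes "f \<in> mpolys m" "m \<le> length z"
  shows "eval_mpoly f (z @ [x]) = eval_mpoly f z"
  unfolding eval_mpoly_def
proof (rule sum.cong)
  fix \<alpha> assume "\<alpha> \<in> supp f"
  then have "expo \<alpha> (length z) = 0"
    using assms by (force simp: mpolys_def in_keys_iff)
  then show "mcoeff f \<alpha> * eval_monomial (z @ [x]) \<alpha> = mcoeff f \<alpha> * eval_monomial z \<alpha>"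
    by (simp add: eval_monomial_append)
qed simp

lemma specialize_add: "specialize (f + g) z = specialize f z + specialize g z"
  unfolding specialize_def by (rule sum_keys_add) (auto simp: distrib_right add_monom)

text \<open>The Newton polygon of \<open>specialize f z\<close> records valuations of these values,
  while the expected polygon records tropical values of the same coefficient polynomials.\<close>

lemma coeff_specialize: "coeff (specialize f z) i = eval_mpoly (coeff_wrt (length z) f i) z"
proof -
  have upd: "eval_monomial z (Poly_Mapping.update (length z) 0 \<alpha>) = eval_monomial z \<alpha>" for \<alpha>
    by (auto simp: eval_monomial_def lookup_update intro!: prod.cong)
  have "coeff (specialize f z) i =
      (\<Sum>\<alpha>\<in>supp f. if expo \<alpha> (length z) = i then mcoeff f \<alpha> * eval_monomial z \<alpha> else 0)"
    by (simp add: specialize_def coeff_sum)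
  also have "\<dots> = (\<Sum>\<alpha>\<in>{\<alpha>\<in>supp f. expo \<alpha> (length z) = i}. mcoeff f \<alpha> * eval_monomial z \<alpha>)"
    by (intro sum.mono_neutral_cong_right) auto
  finally show ?thesis
    by (simp add: coeff_wrt_def eval_mpoly_sum eval_mpoly_single upd)
qed

lemma finite_coeff_wrt_nonzero: "finite {i. coeff_wrt k f i \<noteq> 0}"
proof (rule finite_subset)
  show "{i. coeff_wrt k f i \<noteq> 0} \<subseteq> (\<lambda>\<alpha>. expo \<alpha> k) ` supp f"
  proof
    fix i assume "i \<in> {i. coeff_wrt k f i \<noteq> 0}"
    then have "{\<alpha>\<in>supp f. expo \<alpha> k = i} \<noteq> {}"
      by (metis (mono_tags, lifting) coeff_wrt_def mem_Collect_eq sum.empty)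
    then show "i \<in> (\<lambda>\<alpha>. expo \<alpha> k) ` supp f" by auto
  qed
qed simp

section \<open>Zeros of triangular sets\<close>

lemma triangular_degree_specialize:
  assumes "triangular fs" "length z < length fs"
  shows "degree (specialize (fs ! length z) z) > 0"
proof -
  let ?k = "length z" and ?f = "fs ! length z"
  obtain c d where c: "c \<noteq> 0" "d > 0"
    and low: "\<And>\<alpha>. \<alpha> \<in> supp (?f - Poly_Mapping.single (Poly_Mapping.single ?k d) c) \<Longrightarrow> expo \<alpha> ?k < d"
    using assms(1)[unfolded triangular_def, THEN spec, THEN mp, OF assms(2)] by metis
  define r where "r = ?f - Poly_Mapping.single (Poly_Mapping.single ?k d) c"
  have "?f = r + Poly_Mapping.single (Poly_Mapping.single ?k d) c" by (simp add: r_def)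
  then have "specialize ?f z = specialize (r + Poly_Mapping.single (Poly_Mapping.single ?k d) c) z"
    by (rule arg_cong)
  also have "\<dots> = specialize r z + specialize (Poly_Mapping.single (Poly_Mapping.single ?k d) c) z"
    by (rule specialize_add)
  finally have "specialize ?f z = specialize r z + specialize (Poly_Mapping.single (Poly_Mapping.single ?k d) c) z" .
  \<comment> \<open>The top coefficient is the constant \<open>c\<close>, which no choice of
    \<open>z\<close> can make vanish, and the remaining terms do not reach degree
    \<open>d\<close>.\<close>
  moreover have "coeff (specialize r z) d = 0"
    unfolding specialize_def coeff_sum using low by (intro sum.neutral) (force simp: r_def)
  moreover have "coeff (specialize (Poly_Mapping.single (Poly_Mapping.single ?k d) c) z) d = c"
    using c by (simp add: specialize_def eval_monomial_def lookup_single when_def)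
  ultimately have "coeff (specialize ?f z) d = c" by simp
  then show ?thesis using c le_degree[of "specialize ?f z" d] by auto
qed

text \<open>The earlier equations do not involve the new variable, so they survive the appended
  coordinate.\<close>

lemma variety_extend_triangular:
  assumes "triangular fs" "k < length fs" "z \<in> variety k (set (take k fs))"
    and "poly (specialize (fs ! k) z) x = 0"
  shows "z @ [x] \<in> variety (Suc k) (set (take (Suc k) fs))"
proof -
  have len: "length z = k" using assms(3) by (simp add: variety_def)
  have "eval_mpoly f (z @ [x]) = 0" if f: "f \<in> set (take k fs)" for f
  proof -
    obtain i where i: "i < k" "f = fs ! i" using f assms(2) by (auto simp: in_set_conv_nth)
    then have "f \<in> mpolys (Suc i)" using assms(1,2) by (auto simp: triangular_def)
    then have "eval_mpoly f (z @ [x]) = eval_mpoly f z"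
      using i len by (intro eval_mpoly_append_of_mpolys[of _ "Suc i"]) auto
    then show ?thesis using assms(3) f by (simp add: variety_def)
  qed
  then show ?thesis
    using assms(2,4) len by (auto simp: variety_def take_Suc_conv_app_nth eval_mpoly_append_eq_poly)
qed

text \<open>Each specialized equation has positive degree and hence a root; the induction runs
  downwards from \<open>k = length fs\<close>.\<close>

lemma variety_extend_full:
  fixes fs :: "'a::alg_closed_field mpoly list"
  assumes tri: "triangular fs" and "k \<le> length fs" "z \<in> variety k (set (take k fs))"
  shows "\<exists>y. z @ y \<in> variety (length fs) (set fs)"
  using assms(2,3)
proof (induction k arbitrary: z rule: inc_induct)
  case base
  then show ?case by (auto intro: exI[of _ "[]"])
next
  case (step k)
  then have "length z = k" by (simp add: variety_def)
  then obtain x where "poly (specialize (fs ! k) z) x = 0"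
    using triangular_degree_specialize[OF tri, of z] step.hyps alg_closed_imp_poly_has_root by blast
  then show ?case
    using step.IH[of "z @ [x]"] variety_extend_triangular[OF tri] step by fastforce
qed

text \<open>Otherwise 0 would be an admissible next coordinate, and its extension to a zero of all
  of \<open>fs\<close> would leave the torus.\<close>

lemma coeff_0_specialize_nonzero:
  fixes fs :: "'a::alg_closed_field mpoly list"
  assumes tri: "triangular fs" and torus: "\<And>z j. z \<in> variety (length fs) (set fs) \<Longrightarrow> j < length fs \<Longrightarrow> z ! j \<noteq> 0"
    and k: "k < length fs" and z: "z \<in> variety k (set (take k fs))"
  shows "coeff (specialize (fs ! k) z) 0 \<noteq> 0"
proof
  assume "coeff (specialize (fs ! k) z) 0 = 0"
  then have "z @ [0] \<in> variety (Suc k) (set (take (Suc k) fs))"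
    by (intro variety_extend_triangular[OF tri k z]) (simp add: poly_0_coeff_0)
  then obtain y where "(z @ [0]) @ y \<in> variety (length fs) (set fs)"
    using variety_extend_full[OF tri] k Suc_leI by blast
  moreover have "((z @ [0]) @ y) ! k = 0" using z by (simp add: variety_def nth_append)
  ultimately show False using torus k by blast
qed

section \<open>Valuations of roots and tropical points\<close>

lemma finite_coeff_nonzero: "finite {i. coeff p i \<noteq> 0}"
  by (rule finite_subset[of _ "{..degree p}"]) (auto intro: le_degree)

locale valued_field =
  fixes v :: "'a::field \<Rightarrow> ereal"
  assumes valuation: "is_valuation v"
begin

section \<open>Rules for valuations of sums and products\<close>

lemma v_0 [simp]: "v 0 = \<infinity>" and v_eq_PInf [simp]: "v x = \<infinity> \<longleftrightarrow> x = 0"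
  and v_neq_MInf [simp]: "v x \<noteq> - \<infinity>"
  and v_mult: "v (x * y) = v x + v y"
  and v_add: "min (v x) (v y) \<le> v (x + y)"
  using valuation by (auto simp: is_valuation_def)

lemma v_eq_val: "x \<noteq> 0 \<Longrightarrow> v x = ereal (val v x)"
  by (cases "v x") (auto simp: val_def)

lemma v_1 [simp]: "v 1 = 0"
proof -
  have "v 1 = v 1 + v 1" using v_mult[of 1 1] by simp
  then show ?thesis using v_eq_val[of 1] by (simp add: zero_ereal_def)
qed

lemma v_minus [simp]: "v (- x) = v x"
proof -
  have "v (-1) + v (-1) = 0" using v_mult[of "-1" "-1"] by simp
  then have "v (-1) = 0" using v_eq_val[of "-1"] by (simp add: zero_ereal_def)
  then show ?thesis using v_mult[of "-1" x] by simp
qed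

lemma v_add_eq:
  assumes "v x < v y"
  shows "v (x + y) = v x"
proof (rule antisym)
  \<comment> \<open>Here \<open>x\<close> is written as \<open>(x + y) + (- y)\<close>; as
    \<open>v y\<close> exceeds \<open>v x\<close>, the minimum has to be bounded through
    \<open>v (x + y)\<close>.\<close>
  have "min (v (x + y)) (v y) \<le> v x" using v_add[of "x + y" "- y"] by simp
  then show "v (x + y) \<le> v x" using assms by (auto simp: min_le_iff_disj)
  show "v x \<le> v (x + y)" using v_add[of x y] assms by (simp add: min_def split: if_splits)
qed

lemma v_sum_ge: "(\<And>i. i \<in> I \<Longrightarrow> m \<le> v (f i)) \<Longrightarrow> m \<le> v (\<Sum>i\<in>I. f i)"
proof (induction I rule: infinite_finite_induct)
  case (insert i I)
  then have "m \<le> min (v (f i)) (v (\<Sum>i\<in>I. f i))" by simp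
  also have "\<dots> \<le> v (f i + (\<Sum>i\<in>I. f i))" by (rule v_add)
  finally show ?case using insert by simp
qed auto

text \<open>The bound must be finite because an empty sum is 0, of value infinity.\<close>

lemma v_sum_gt: "m < \<infinity> \<Longrightarrow> (\<And>i. i \<in> I \<Longrightarrow> m < v (f i)) \<Longrightarrow> m < v (\<Sum>i\<in>I. f i)"
proof (induction I rule: infinite_finite_induct)
  case (insert i I)
  then have "m < min (v (f i)) (v (\<Sum>i\<in>I. f i))" by simp
  also have "\<dots> \<le> v (f i + (\<Sum>i\<in>I. f i))" by (rule v_add)
  finally show ?case using insert by simp
qed auto

lemma v_mult_gt: "ereal a < v x \<Longrightarrow> ereal b \<le> v y \<Longrightarrow> ereal (a + b) < v (x * y)"
  by (cases "v x"; cases "v y") (auto simp: v_mult)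

lemma v_power: "v x = ereal a \<Longrightarrow> v (x ^ n) = ereal (a * real n)"
  by (induction n) (auto simp: v_mult zero_ereal_def distrib_left)

lemma v_prod: "(\<And>j. j \<in> J \<Longrightarrow> v (f j) = ereal (a j)) \<Longrightarrow> v (\<Prod>j\<in>J. f j) = ereal (\<Sum>j\<in>J. a j)"
  by (induction J rule: infinite_finite_induct) (auto simp: v_mult zero_ereal_def)

section \<open>Valuations of polynomial values against tropical values\<close>

lemma v_eval_monomial:
  assumes "map v z = map ereal w"
  shows "v (eval_monomial z \<alpha>) = ereal (dot w \<alpha>)"
proof -
  have "length z = length w" using assms by (metis length_map)
  moreover have "v (z ! j) = ereal (w ! j)" if "j < length w" for j
    using assms that calculation by (metis nth_map)
  ultimately show ?thesis
    unfolding eval_monomial_def dot_def by (auto intro!: v_prod v_power)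
qed

lemma v_term:
  assumes "map v z = map ereal w" "\<alpha> \<in> supp f"
  shows "v (mcoeff f \<alpha> * eval_monomial z \<alpha>) = ereal (dot w \<alpha> + val v (mcoeff f \<alpha>))"
  using assms by (simp add: v_mult v_eval_monomial v_eq_val in_keys_iff add.commute)

lemma trop_le: "\<alpha> \<in> supp f \<Longrightarrow> trop v f w \<le> dot w \<alpha> + val v (mcoeff f \<alpha>)"
  unfolding trop_def by (rule Min_le) auto

lemma trop_attained:
  assumes "f \<noteq> 0"
  obtains \<alpha> where "\<alpha> \<in> supp f" "trop v f w = dot w \<alpha> + val v (mcoeff f \<alpha>)"
proof -
  have "trop v f w \<in> (\<lambda>\<alpha>. dot w \<alpha> + val v (mcoeff f \<alpha>)) ` supp f"
    unfolding trop_def using assms by (intro Min_in) auto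
  then show ?thesis using that by auto
qed

lemma trop_le_v_eval:
  assumes "map v z = map ereal w"
  shows "ereal (trop v f w) \<le> v (eval_mpoly f z)"
  unfolding eval_mpoly_def by (intro v_sum_ge) (simp add: v_term[OF assms] trop_le)

text \<open>A single term of least valuation dominates the sum of all others.\<close>

lemma v_eval_eq_trop:
  assumes z: "map v z = map ereal w"
    and unique: "{\<alpha>\<in>supp f. dot w \<alpha> + val v (mcoeff f \<alpha>) = trop v f w} = {\<beta>}"
  shows "v (eval_mpoly f z) = ereal (trop v f w)"
proof -
  have \<beta>: "\<beta> \<in> supp f" "dot w \<beta> + val v (mcoeff f \<beta>) = trop v f w" using unique by auto
  let ?t = "\<lambda>\<alpha>. mcoeff f \<alpha> * eval_monomial z \<alpha>"
  have "ereal (trop v f w) < v (\<Sum>\<alpha>\<in>supp f - {\<beta>}. ?t \<alpha>)"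
  proof (rule v_sum_gt)
    fix \<alpha> assume \<alpha>: "\<alpha> \<in> supp f - {\<beta>}"
    then have "trop v f w < dot w \<alpha> + val v (mcoeff f \<alpha>)"
      using trop_le[of \<alpha> f w] unique by (force simp: order_less_le)
    then show "ereal (trop v f w) < v (?t \<alpha>)" using \<alpha> by (simp add: v_term[OF z])
  qed simp
  then have "v (?t \<beta>) < v (\<Sum>\<alpha>\<in>supp f - {\<beta>}. ?t \<alpha>)" using \<beta> by (simp add: v_term[OF z])
  from v_add_eq[OF this] have "v (eval_mpoly f z) = v (?t \<beta>)"
    using \<beta>(1) unfolding eval_mpoly_def by (subst sum.remove[of _ \<beta>]) auto
  then show ?thesis using \<beta> by (simp add: v_term[OF z])
qed

text \<open>Multiplying by a linear factor whose root does not have valuation \<open>w\<close> shifts, but never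
  duplicates, the index at which \<open>v (coeff p k) + w * k\<close> is minimal.\<close>

lemma unique_minimum_prod_linear:
  assumes "\<And>x. x \<in># A \<Longrightarrow> v x \<noteq> ereal w"
  shows "\<exists>k m. v (coeff (\<Prod>x\<in>#A. [:-x, 1:]) k) = ereal (m - w * real k) \<and>
    (\<forall>j. j \<noteq> k \<longrightarrow> ereal (m - w * real j) < v (coeff (\<Prod>x\<in>#A. [:-x, 1:]) j))"
  using assms
proof (induction A)
  case empty
  have "v (coeff (1::'a poly) j) = \<infinity>" if "j \<noteq> 0" for j using that by simp
  then show ?case by (intro exI[of _ 0]) (simp add: zero_ereal_def)
next
  case (add x A)
  define q where "q = (\<Prod>x\<in>#A. [:-x, 1:])"
  define p where "p = [:-x, 1:] * q"
  obtain k m where k: "v (coeff q k) = ereal (m - w * real k)"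
    and gt: "\<And>j. j \<noteq> k \<Longrightarrow> ereal (m - w * real j) < v (coeff q j)"
    using add unfolding q_def by fastforce
  have ge: "ereal (m - w * real j) \<le> v (coeff q j)" for j
    using k gt[of j] by (cases "j = k") auto
  have p_0: "coeff p 0 = - (x * coeff q 0)" by (simp add: p_def)
  have p_Suc: "coeff p (Suc j) = coeff q j + - (x * coeff q (Suc j))" for j
    by (simp add: p_def)
  have "v x \<noteq> ereal w" using add.prems by simp
  then consider "ereal w < v x" | a where "v x = ereal a" "a < w"
    by (cases "v x") (auto simp: neq_iff)
  then have "\<exists>k m. v (coeff p k) = ereal (m - w * real k) \<and>
    (\<forall>j. j \<noteq> k \<longrightarrow> ereal (m - w * real j) < v (coeff p j))"
  proof cases
    case 1
    \<comment> \<open>The root has value above \<open>w\<close> and may be 0. The shifted summand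
      \<open>coeff q j\<close> wins at the minimum, so the index moves to \<open>Suc k\<close> and
      the constant becomes \<open>m + w\<close>.\<close>
    have x: "ereal (m + w - w * real j) < v (- (x * coeff q j))" for j
      using v_mult_gt[OF 1 ge[of j]] by (simp add: algebra_simps)
    have "v (coeff p (Suc k)) = ereal (m + w - w * real (Suc k))"
      unfolding p_Suc using x[of "Suc k"] k by (subst v_add_eq) (auto simp: algebra_simps)
    moreover have "ereal (m + w - w * real j) < v (coeff p j)" if "j \<noteq> Suc k" for j
    proof (cases j)
      case 0
      then show ?thesis using x[of 0] p_0 by simp
    next
      case (Suc i)
      have "ereal (m + w - w * real j) < v (coeff q i)"
        using gt[of i] that Suc by (simp add: algebra_simps)
      then have "ereal (m + w - w * real j) < min (v (coeff q i)) (v (- (x * coeff q (Suc i))))"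
        using x[of j] Suc by simp
      also have "\<dots> \<le> v (coeff p j)" unfolding Suc p_Suc by (rule v_add)
      finally show ?thesis .
    qed
    ultimately show ?thesis by blast
  next
    case 2
    \<comment> \<open>The root has value \<open>a\<close> below \<open>w\<close>. Now the summand
      multiplied by \<open>x\<close> wins, so the index stays \<open>k\<close> and the constant
      becomes \<open>m + a\<close>.\<close>
    have q: "ereal (m + a - w * real (Suc j)) < v (coeff q j)" for j
      using ge[of j] 2(2) by (auto elim!: less_le_trans[rotated] simp: algebra_simps)
    have xq: "v (- (x * coeff q j)) = ereal a + v (coeff q j)" for j using 2(1) by (simp add: v_mult)
    have "v (coeff p k) = ereal (m + a - w * real k)"
    proof (cases k)
      case 0
      then show ?thesis using k xq[of 0] by (simp add: p_0 algebra_simps)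
    next
      case (Suc i)
      have "v (- (x * coeff q k)) < v (coeff q i)"
        using q[of i] xq[of k] k Suc by (simp add: algebra_simps)
      from v_add_eq[OF this] show ?thesis unfolding Suc p_Suc
        using xq[of k] k Suc by (simp add: algebra_simps)
    qed
    moreover have "ereal (m + a - w * real j) < v (coeff p j)" if "j \<noteq> k" for j
    proof -
      have x: "ereal (m + a - w * real j) < v (- (x * coeff q j))"
        unfolding xq using gt[OF that] by (cases "v (coeff q j)") auto
      show ?thesis
      proof (cases j)
        case 0
        then show ?thesis using x p_0 by simp
      next
        case (Suc i)
        have "ereal (m + a - w * real j) < min (v (coeff q i)) (v (- (x * coeff q (Suc i))))"
          using x q[of i] Suc by simp
        also have "\<dots> \<le> v (coeff p j)" unfolding Suc p_Suc by (rule v_add)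
        finally show ?thesis .
      qed
    qed
    ultimately show ?thesis by blast
  qed
  then show ?case by (simp add: p_def q_def)
qed

text \<open>Scaling by \<open>c\<close> moves all values by the same amount, so without a root of
  value \<open>w\<close> the minimizing index would be unique.\<close>

lemma root_of_double_minimum:
  assumes p: "p = smult c (\<Prod>x\<in>#A. [:-x, 1:])" "c \<noteq> 0" and "i \<noteq> j"
    and i: "v (coeff p i) = ereal (m - w * real i)" and j: "v (coeff p j) = ereal (m - w * real j)"
    and ge: "\<And>k. ereal (m - w * real k) \<le> v (coeff p k)"
  shows "\<exists>x\<in>#A. v x = ereal w"
proof (rule ccontr)
  assume "\<not> ?thesis"
  then obtain k m' where k: "v (coeff (\<Prod>x\<in>#A. [:-x, 1:]) k) = ereal (m' - w * real k)"
    and gt: "\<And>j. j \<noteq> k \<Longrightarrow> ereal (m' - w * real j) < v (coeff (\<Prod>x\<in>#A. [:-x, 1:]) j)"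
    using unique_minimum_prod_linear[of A w] by metis
  have v_p: "v (coeff p l) = ereal (val v c) + v (coeff (\<Prod>x\<in>#A. [:-x, 1:]) l)" for l
    using p by (simp add: v_mult v_eq_val)
  \<comment> \<open>The bound at \<open>k\<close> gives this inequality; an index other than
    \<open>k\<close> attaining the minimum gives the opposite strict one, so \<open>i\<close> and
    \<open>j\<close> would both equal \<open>k\<close>.\<close>
  have "m \<le> m' + val v c" using ge[of k] unfolding v_p k by simp
  moreover have "m' + val v c < m" if "l \<noteq> k" "v (coeff p l) = ereal (m - w * real l)" for l
    using gt[OF that(1)] that(2) unfolding v_p by (cases "v (coeff (\<Prod>x\<in>#A. [:-x, 1:]) l)") auto
  ultimately show False using \<open>i \<noteq> j\<close> i j by (metis not_le)
qed

section \<open>Slopes of Newton polygons as valuations of roots\<close>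

lemma newton_polygon_eq_upper_hull:
  "newton_polygon v p = upper_hull {(real i, val v (coeff p i)) | i. coeff p i \<noteq> 0}"
  by (simp add: newton_polygon_def upper_hull_def)

lemma expected_newton_polygon_eq_upper_hull:
  "expected_newton_polygon v w f = upper_hull {(real i, trop v (coeff_wrt (length w) f i) w) | i.
     coeff_wrt (length w) f i \<noteq> 0}"
  by (simp add: expected_newton_polygon_def upper_hull_def)

text \<open>The ends of the edge give a double minimum; vanishing coefficients satisfy the bound
  because their value is infinite.\<close>

lemma root_of_newton_slope:
  assumes "p = smult c (\<Prod>x\<in>#A. [:-x, 1:])" "c \<noteq> 0" and w: "w \<in> neg_slopes (newton_polygon v p)"
  shows "\<exists>x\<in>#A. v x = ereal w"
proof -
  obtain i j m where ij: "i < j" "coeff p i \<noteq> 0" "coeff p j \<noteq> 0"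
    and val: "val v (coeff p i) = m - w * real i" "val v (coeff p j) = m - w * real j"
    and ge: "\<forall>k. coeff p k \<noteq> 0 \<longrightarrow> m - w * real k \<le> val v (coeff p k)"
    using neg_slopes_upper_hull_graph[OF finite_coeff_nonzero w[unfolded newton_polygon_eq_upper_hull]]
    by blast
  have "ereal (m - w * real k) \<le> v (coeff p k)" for k
    using ge by (cases "coeff p k = 0") (auto simp: v_eq_val)
  moreover have "v (coeff p i) = ereal (m - w * real i)" "v (coeff p j) = ereal (m - w * real j)"
    using ij val by (auto simp: v_eq_val)
  ultimately show ?thesis using root_of_double_minimum[OF assms(1,2), of i j m w] ij by blast
qed

end

locale residue_field = valued_field v for v :: "'a::field \<Rightarrow> ereal" +
  fixes psi :: "real \<Rightarrow> 'a" and res :: "'a \<Rightarrow> 'k::field"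
  assumes splitting: "is_splitting v psi" and residue: "is_residue_map v res"
begin

section \<open>The value group, its splitting, and the reduction map\<close>

lemma value_group_0: "0 \<in> value_group v"
  by (auto simp: value_group_def zero_ereal_def[symmetric] intro: exI[of _ 1])

lemma value_groupI: "v x = ereal a \<Longrightarrow> a \<in> value_group v"
  by (cases "x = 0") (auto simp: value_group_def)

lemma value_group_val: "x \<noteq> 0 \<Longrightarrow> val v x \<in> value_group v"
  by (auto simp: value_group_def v_eq_val)

lemma value_group_add: "a \<in> value_group v \<Longrightarrow> b \<in> value_group v \<Longrightarrow> a + b \<in> value_group v"
  unfolding value_group_def by clarsimp (metis mult_eq_0_iff plus_ereal.simps(1) v_mult)

lemma value_group_minus:
  assumes "a \<in> value_group v"
  shows "- a \<in> value_group v"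
proof -
  obtain x where x: "x \<noteq> 0" "v x = ereal a" using assms by (auto simp: value_group_def)
  have "v x + v (inverse x) = 0" using v_mult[of x "inverse x"] x by simp
  then have "v (inverse x) = ereal (- a)" using x by (cases "v (inverse x)") (auto simp: zero_ereal_def)
  then show ?thesis using x by (auto simp: value_group_def intro: exI[of _ "inverse x"])
qed

lemma value_group_sum: "(\<And>i. i \<in> I \<Longrightarrow> a i \<in> value_group v) \<Longrightarrow> (\<Sum>i\<in>I. a i) \<in> value_group v"
  by (induction I rule: infinite_finite_induct) (auto simp: value_group_0 value_group_add)

lemma v_psi: "a \<in> value_group v \<Longrightarrow> v (psi a) = ereal a"
  using splitting by (simp add: is_splitting_def)

lemma psi_add: "a \<in> value_group v \<Longrightarrow> b \<in> value_group v \<Longrightarrow> psi (a + b) = psi a * psi b"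
  using splitting by (simp add: is_splitting_def)

lemma psi_0: "psi 0 = 1"
proof -
  have "psi 0 = psi 0 * psi 0" using psi_add[OF value_group_0 value_group_0] by simp
  moreover have "psi 0 \<noteq> 0" using v_psi[OF value_group_0] by auto
  ultimately show ?thesis by simp
qed

lemma psi_sum:
  "(\<And>i. i \<in> I \<Longrightarrow> a i \<in> value_group v) \<Longrightarrow> psi (\<Sum>i\<in>I. a i) = (\<Prod>i\<in>I. psi (a i))"
  by (induction I rule: infinite_finite_induct) (auto simp: psi_0 psi_add value_group_sum)

lemma psi_times_nat:
  assumes "a \<in> value_group v"
  shows "a * real n \<in> value_group v" "psi (a * real n) = psi a ^ n"
  using value_group_sum[of "{..<n}" "\<lambda>_. a"] psi_sum[of "{..<n}" "\<lambda>_. a"] assms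
  by (auto simp: mult.commute)

lemma res_1: "res 1 = 1"
  and res_add: "0 \<le> v x \<Longrightarrow> 0 \<le> v y \<Longrightarrow> res (x + y) = res x + res y"
  and res_mult: "0 \<le> v x \<Longrightarrow> 0 \<le> v y \<Longrightarrow> res (x * y) = res x * res y"
  and res_eq_0_iff: "0 \<le> v x \<Longrightarrow> res x = 0 \<longleftrightarrow> 0 < v x"
  using residue by (auto simp: is_residue_map_def)

lemma res_0: "res 0 = 0"
  by (simp add: res_eq_0_iff)

lemma res_sum: "(\<And>i. i \<in> I \<Longrightarrow> 0 \<le> v (f i)) \<Longrightarrow> res (\<Sum>i\<in>I. f i) = (\<Sum>i\<in>I. res (f i))"
  by (induction I rule: infinite_finite_induct) (auto simp: res_0 res_add v_sum_ge)

lemma res_power: "v x = 0 \<Longrightarrow> res (x ^ n) = res x ^ n"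
  using v_power[of x 0] by (induction n) (auto simp: res_1 res_mult zero_ereal_def)

lemma res_prod: "(\<And>i. i \<in> I \<Longrightarrow> v (f i) = 0) \<Longrightarrow> res (\<Prod>i\<in>I. f i) = (\<Prod>i\<in>I. res (f i))"
proof (induction I rule: infinite_finite_induct)
  case (insert i I)
  moreover have "v (\<Prod>i\<in>I. f i) = 0" using v_prod[of I f "\<lambda>_. 0"] insert by (simp add: zero_ereal_def)
  ultimately show ?case by (simp add: res_mult)
qed (auto simp: res_1)

lemma v_normalized: "x \<noteq> 0 \<Longrightarrow> v (x * psi (- val v x)) = 0"
  using v_psi[OF value_group_minus[OF value_group_val, of x]]
  by (simp add: v_mult v_eq_val zero_ereal_def)

text \<open>Nothing drops out under reduction: a normalized coefficient has value 0, hence a nonzero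
  residue.\<close>

lemma supp_initial_form:
  "supp (initial_form v psi res w f) = {\<alpha>\<in>supp f. dot w \<alpha> + val v (mcoeff f \<alpha>) = trop v f w}"
proof -
  have "mcoeff (initial_form v psi res w f) \<alpha> =
      (if \<alpha> \<in> supp f \<and> dot w \<alpha> + val v (mcoeff f \<alpha>) = trop v f w
       then res (mcoeff f \<alpha> * psi (- val v (mcoeff f \<alpha>))) else 0)" for \<alpha>
    by (simp add: initial_form_def lookup_sum lookup_single when_def sum.delta')
  moreover have "res (mcoeff f \<alpha> * psi (- val v (mcoeff f \<alpha>))) \<noteq> 0" if "\<alpha> \<in> supp f" for \<alpha>
    using that v_normalized[of "mcoeff f \<alpha>"] by (simp add: res_eq_0_iff in_keys_iff)
  ultimately show ?thesis by (auto simp: in_keys_iff split: if_splits)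
qed

lemma v_eval_eq_trop_of_monomial:
  assumes "map v z = map ereal w" "is_monomial (initial_form v psi res w f)"
  shows "v (eval_mpoly f z) = ereal (trop v f w)"
proof -
  obtain \<beta> where "supp (initial_form v psi res w f) = {\<beta>}"
    using assms(2) by (auto simp: is_monomial_def)
  then show ?thesis using v_eval_eq_trop[OF assms(1)] supp_initial_form by metis
qed

text \<open>Exact values at two vertices, from monomial initial forms, and tropical lower bounds at
  all other indices combine to a double minimum for \<open>specialize f z\<close>.\<close>

lemma root_of_expected_slope:
  assumes z: "map v z = map ereal ws" and p: "specialize f z = smult c (\<Prod>x\<in>#A. [:-x, 1:])" "c \<noteq> 0"
    and unique: "unique_newton_polygon v psi res ws f"
    and w: "w \<in> neg_slopes (expected_newton_polygon v ws f)"
  shows "\<exists>x\<in>#A. v x = ereal w"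
proof -
  let ?f = "\<lambda>i. coeff_wrt (length ws) f i"
  have len: "length z = length ws" using z by (metis length_map)
  obtain i j m where ij: "i < j" "?f i \<noteq> 0" "?f j \<noteq> 0"
    and trop: "trop v (?f i) ws = m - w * real i" "trop v (?f j) ws = m - w * real j"
    and ge: "\<forall>k. ?f k \<noteq> 0 \<longrightarrow> m - w * real k \<le> trop v (?f k) ws"
    and ext: "(real i, trop v (?f i) ws) extreme_point_of expected_newton_polygon v ws f"
      "(real j, trop v (?f j) ws) extreme_point_of expected_newton_polygon v ws f"
    using neg_slopes_upper_hull_graph[OF finite_coeff_wrt_nonzero
        w[unfolded expected_newton_polygon_eq_upper_hull]]
    unfolding expected_newton_polygon_eq_upper_hull by blast
  have coeff: "coeff (specialize f z) k = eval_mpoly (?f k) z" for k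
    by (simp add: coeff_specialize len)
  have "is_monomial (initial_form v psi res ws (?f i))" "is_monomial (initial_form v psi res ws (?f j))"
    using unique ij ext by (auto simp: unique_newton_polygon_def)
  then have "v (coeff (specialize f z) i) = ereal (m - w * real i)"
    "v (coeff (specialize f z) j) = ereal (m - w * real j)"
    using v_eval_eq_trop_of_monomial[OF z] trop by (auto simp: coeff)
  moreover have "ereal (m - w * real k) \<le> v (coeff (specialize f z) k)" for k
  proof (cases "?f k = 0")
    case False
    then have "ereal (m - w * real k) \<le> ereal (trop v (?f k) ws)" using ge by simp
    also have "\<dots> \<le> v (coeff (specialize f z) k)" unfolding coeff by (rule trop_le_v_eval[OF z])
    finally show ?thesis .
  qed (simp add: coeff)
  ultimately show ?thesis using root_of_double_minimum[OF p, of i j m w] ij(1) by blast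
qed

text \<open>Rescaling the equation at \<open>z\<close> by \<open>psi (- trop v f w)\<close> puts
  every term into the valuation ring. Reduction kills the terms off the minimum and turns the others
  into the terms of the initial form at the reduced point.\<close>

lemma eval_initial_form_eq_0:
  assumes z: "map v z = map ereal w" and f: "eval_mpoly f z = 0"
  shows "eval_mpoly (initial_form v psi res w f) (map2 (\<lambda>x a. res (x * psi (- a))) z w) = 0"
proof (cases "f = 0")
  case False
  have len: "length z = length w" using z by (metis length_map)
  have v_nth: "v (z ! j) = ereal (w ! j)" if "j < length w" for j
    using z len that by (metis nth_map)
  have w_vg: "- (w ! j) \<in> value_group v" if "j < length w" for j
    using v_nth[OF that] by (intro value_group_minus value_groupI)
  define zb where "zb = map2 (\<lambda>x a. res (x * psi (- a))) z w"
  define M where "M = {\<alpha>\<in>supp f. dot w \<alpha> + val v (mcoeff f \<alpha>) = trop v f w}"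
  define t where "t \<alpha> = psi (- trop v f w) * (mcoeff f \<alpha> * eval_monomial z \<alpha>)" for \<alpha>
  \<comment> \<open>The entries of \<open>w\<close> are values of the coordinates of
    \<open>z\<close>, so these sums stay in the value group, where \<open>psi\<close> turns sums
    into products.\<close>
  have dot_vg: "- dot w \<alpha> \<in> value_group v"
    and psi_dot: "psi (- dot w \<alpha>) = (\<Prod>j<length w. psi (- (w ! j)) ^ expo \<alpha> j)" for \<alpha>
  proof -
    have eq: "- dot w \<alpha> = (\<Sum>j<length w. - (w ! j) * real (expo \<alpha> j))"
      by (simp add: dot_def sum_negf)
    show "- dot w \<alpha> \<in> value_group v"
      unfolding eq by (intro value_group_sum psi_times_nat w_vg) auto
    have "psi (- dot w \<alpha>) = (\<Prod>j<length w. psi (- (w ! j) * real (expo \<alpha> j)))"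
      unfolding eq by (intro psi_sum psi_times_nat w_vg) auto
    also have "\<dots> = (\<Prod>j<length w. psi (- (w ! j)) ^ expo \<alpha> j)"
      by (intro prod.cong psi_times_nat w_vg) auto
    finally show "psi (- dot w \<alpha>) = (\<Prod>j<length w. psi (- (w ! j)) ^ expo \<alpha> j)" .
  qed
  have trop_vg: "- trop v f w \<in> value_group v"
  proof -
    obtain \<alpha> where "\<alpha> \<in> supp f" "trop v f w = dot w \<alpha> + val v (mcoeff f \<alpha>)"
      by (rule trop_attained[OF False])
    then show ?thesis
      using value_group_add[OF dot_vg value_group_minus[OF value_group_val], of "mcoeff f \<alpha>" \<alpha>]
      by (simp add: in_keys_iff)
  qed
  have v_t: "v (t \<alpha>) = ereal (dot w \<alpha> + val v (mcoeff f \<alpha>) - trop v f w)" if "\<alpha> \<in> supp f" for \<alpha>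
    unfolding t_def v_mult[of "psi _"] v_term[OF z that] v_psi[OF trop_vg] by simp
  have v_u: "v (z ! j * psi (- (w ! j))) = 0" if "j < length w" for j
    using v_nth[OF that] v_psi[OF w_vg[OF that]] by (simp add: v_mult zero_ereal_def)
  \<comment> \<open>For a minimizing exponent, \<open>psi (- trop v f w)\<close> splits into the
    factor normalizing the coefficient and those normalizing the coordinates of
    \<open>z\<close>.\<close>
  have res_t: "res (mcoeff f \<alpha> * psi (- val v (mcoeff f \<alpha>))) * eval_monomial zb \<alpha> = res (t \<alpha>)"
    if \<alpha>: "\<alpha> \<in> M" for \<alpha>
  proof -
    have supp: "mcoeff f \<alpha> \<noteq> 0" and trop: "- trop v f w = - val v (mcoeff f \<alpha>) + - dot w \<alpha>"
      using \<alpha> by (auto simp: M_def in_keys_iff)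
    let ?u = "\<lambda>j. z ! j * psi (- (w ! j))"
    have v_pow: "v (?u j ^ expo \<alpha> j) = 0" if "j < length w" for j
      using v_power[of "?u j" 0] v_u[OF that] by (simp add: zero_ereal_def)
    have "eval_monomial zb \<alpha> = (\<Prod>j<length w. res (?u j) ^ expo \<alpha> j)"
      by (simp add: eval_monomial_def zb_def len)
    also have "\<dots> = (\<Prod>j<length w. res (?u j ^ expo \<alpha> j))"
      by (intro prod.cong res_power[symmetric] v_u) auto
    also have "\<dots> = res (\<Prod>j<length w. ?u j ^ expo \<alpha> j)"
      by (intro res_prod[symmetric] v_pow) auto
    finally have zb: "eval_monomial zb \<alpha> = res (\<Prod>j<length w. ?u j ^ expo \<alpha> j)" .
    have prod_u: "(\<Prod>j<length w. ?u j ^ expo \<alpha> j) = eval_monomial z \<alpha> * psi (- dot w \<alpha>)"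
      by (simp add: psi_dot eval_monomial_def len power_mult_distrib prod.distrib)
    have "v (\<Prod>j<length w. ?u j ^ expo \<alpha> j) = 0"
      using v_prod[of "{..<length w}" "\<lambda>j. ?u j ^ expo \<alpha> j" "\<lambda>_. 0"] v_pow by (simp add: zero_ereal_def)
    then have "res (mcoeff f \<alpha> * psi (- val v (mcoeff f \<alpha>))) * eval_monomial zb \<alpha> =
        res (mcoeff f \<alpha> * psi (- val v (mcoeff f \<alpha>)) * (eval_monomial z \<alpha> * psi (- dot w \<alpha>)))"
      unfolding zb using v_normalized[OF supp] by (subst res_mult) (auto simp: prod_u)
    also have "mcoeff f \<alpha> * psi (- val v (mcoeff f \<alpha>)) * (eval_monomial z \<alpha> * psi (- dot w \<alpha>)) = t \<alpha>"
      unfolding t_def trop psi_add[OF value_group_minus[OF value_group_val[OF supp]] dot_vg]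
      by (simp add: mult_ac)
    finally show ?thesis .
  qed
  have "eval_mpoly (initial_form v psi res w f) zb = (\<Sum>\<alpha>\<in>M. res (t \<alpha>))"
    unfolding initial_form_def eval_mpoly_sum M_def[symmetric]
    by (intro sum.cong) (auto simp: eval_mpoly_single res_t)
  also have "\<dots> = res (\<Sum>\<alpha>\<in>M. t \<alpha>)"
    by (intro res_sum[symmetric]) (auto simp: M_def v_t)
  \<comment> \<open>All \<open>t \<alpha>\<close> sum to 0, so the sum over \<open>M\<close> is
    minus a sum of terms of positive value, whose residue is 0.\<close>
  also have "(\<Sum>\<alpha>\<in>M. t \<alpha>) = - (\<Sum>\<alpha>\<in>supp f - M. t \<alpha>)"
  proof -
    have "(\<Sum>\<alpha>\<in>supp f. t \<alpha>) = 0"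
      using f unfolding t_def sum_distrib_left[symmetric] by (simp add: eval_mpoly_def)
    then show ?thesis
      using sum.subset_diff[of M "supp f" t] by (simp add: M_def eq_neg_iff_add_eq_0 add.commute)
  qed
  also have "res \<dots> = 0"
  proof -
    have "0 < v (\<Sum>\<alpha>\<in>supp f - M. t \<alpha>)"
    proof (rule v_sum_gt)
      fix \<alpha> assume "\<alpha> \<in> supp f - M"
      then show "0 < v (t \<alpha>)"
        using trop_le[of \<alpha> f w] by (auto simp: v_t M_def)
    qed simp
    then show ?thesis by (subst res_eq_0_iff) auto
  qed
  finally show ?thesis by (simp add: zb_def)
qed (simp add: initial_form_def)

lemma Trop_of_variety:
  assumes z: "map v z = map ereal w" and S: "z \<in> variety n S"
  shows "w \<in> Trop v psi res n (ideal_gen n S)"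
proof -
  have len: "length z = length w" "length z = n"
    using z S by (metis length_map, simp add: variety_def)
  define zb where "zb = map2 (\<lambda>x a. res (x * psi (- a))) z w"
  \<comment> \<open>Each \<open>z ! j * psi (- (w ! j))\<close> has value 0, so the reduced point
    lies in the torus over the residue field.\<close>
  have "0 \<notin> set zb"
  proof
    assume "0 \<in> set zb"
    then obtain j where j: "j < n" "res (z ! j * psi (- (w ! j))) = 0"
      using len by (auto simp: zb_def in_set_conv_nth)
    have v_j: "v (z ! j) = ereal (w ! j)" using z len j(1) by (metis nth_map)
    then have "- (w ! j) \<in> value_group v"
      by (intro value_group_minus value_groupI)
    then have "v (z ! j * psi (- (w ! j))) = 0"
      using v_j v_psi by (simp add: v_mult zero_ereal_def)
    then show False using j(2) res_eq_0_iff by simp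
  qed
  moreover have "eval_mpoly g zb = 0" if "g \<in> initial_ideal v psi res n w (ideal_gen n S)" for g
    using that unfolding initial_ideal_def
  proof (rule eval_mpoly_ideal_gen)
    fix h assume "h \<in> initial_form v psi res w ` ideal_gen n S"
    then obtain f where f: "f \<in> ideal_gen n S" "h = initial_form v psi res w f" by blast
    have "eval_mpoly f z = 0"
      using S by (intro eval_mpoly_ideal_gen[OF f(1)]) (auto simp: variety_def)
    then show "eval_mpoly h zb = 0" using eval_initial_form_eq_0[OF z] f(2) by (simp add: zb_def)
  qed
  ultimately have "\<not> is_monomial g" if "g \<in> initial_ideal v psi res n w (ideal_gen n S)" for g
    using that eval_mpoly_is_monomial by blast
  then show ?thesis using len by (auto simp: Trop_def)
qed

end

section \<open>The algorithm\<close>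

text \<open>For a valuation \<open>v\<close>, matching real entries also forces the coordinates of
  \<open>z\<close> to be nonzero.\<close>

fun point_over :: "('a::field \<Rightarrow> ereal) \<Rightarrow> 'a mpoly list \<Rightarrow> 'a list \<Rightarrow> real list \<Rightarrow> bool" where
  "point_over v fs z ws \<longleftrightarrow> z \<in> variety (length ws) (set (take (length ws) fs)) \<and> map v z = map ereal ws"

text \<open>In \<open>Looping\<close> some root exists that the algorithm need not know; in
  \<open>Rooted\<close> it must be the computed one, since the next slope depends on it.\<close>

fun alg_invariant :: "('a::field \<Rightarrow> ereal) \<Rightarrow> 'a mpoly list \<Rightarrow> 'a state \<Rightarrow> bool" where
  "alg_invariant v fs Init \<longleftrightarrow> True"
| "alg_invariant v fs (Looping ws) \<longleftrightarrow> length ws \<le> length fs \<and> (\<exists>z. point_over v fs z ws)"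
| "alg_invariant v fs (Rooted ws z) \<longleftrightarrow> length ws < length fs \<and> point_over v fs z ws"
| "alg_invariant v fs (Returned ws) \<longleftrightarrow> length ws = length fs \<and> (\<exists>z. point_over v fs z ws)"

text \<open>A coordinate after the first is picked in one or two steps, so \<open>Rooted\<close>
  takes the even number between consecutive odd ranks of \<open>Looping\<close>.\<close>

fun alg_rank :: "nat \<Rightarrow> 'a state \<Rightarrow> nat" where
  "alg_rank n Init = 0"
| "alg_rank n (Looping ws) = 2 * length ws + 1"
| "alg_rank n (Rooted ws z) = 2 * length ws + 2"
| "alg_rank n (Returned ws) = 2 * n + 2"

lemma alg_rank_le: "alg_invariant v fs s \<Longrightarrow> alg_rank (length fs) s \<le> 2 * length fs + 2"
  by (cases s) auto

lemma alg_rank_increases: "alg_step v psi res fs s s' \<Longrightarrow> alg_rank (length fs) s < alg_rank (length fs) s'"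
  by (cases rule: alg_step.cases) auto

locale tropical_point_algorithm = residue_field v psi res
  for v :: "'a::alg_closed_field \<Rightarrow> ereal" and psi and res :: "'a \<Rightarrow> 'k::field" +
  fixes fs :: "'a mpoly list"
  assumes nonempty: "fs \<noteq> []" and triangular: "triangular fs"
    and torus: "\<And>z j. z \<in> variety (length fs) (set fs) \<Longrightarrow> j < length fs \<Longrightarrow> z ! j \<noteq> 0"
begin

lemma point_over_length: "point_over v fs z ws \<Longrightarrow> length z = length ws"
  by (simp add: variety_def)

lemma specialize_coeffs:
  assumes "point_over v fs z ws" "length ws < length fs"
  shows "degree (specialize (fs ! length ws) z) > 0" "coeff (specialize (fs ! length ws) z) 0 \<noteq> 0"
  using assms triangular_degree_specialize[OF triangular, of z]
    coeff_0_specialize_nonzero[OF triangular torus, of "length ws" z] point_over_length[OF assms(1)]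
  by auto

lemma specialize_splits:
  assumes "point_over v fs z ws" "length ws < length fs"
  obtains c A where "specialize (fs ! length ws) z = smult c (\<Prod>x\<in>#A. [:-x, 1:])" "c \<noteq> 0"
  using alg_closed_imp_factorization[of "specialize (fs ! length ws) z"] specialize_coeffs[OF assms]
  by (metis degree_0 leading_coeff_0_iff less_numeral_extra(3))

lemma point_over_append:
  assumes "point_over v fs z ws" "length ws < length fs"
    and p: "specialize (fs ! length ws) z = smult c (\<Prod>x\<in>#A. [:-x, 1:])" and x: "x \<in># A" "v x = ereal w"
  shows "point_over v fs (z @ [x]) (ws @ [w])"
proof -
  have "poly (specialize (fs ! length ws) z) x = 0"
    using x(1) unfolding p by (auto simp: poly_prod_mset prod_mset_zero_iff image_iff)
  then show ?thesis
    using variety_extend_triangular[OF triangular assms(2)] assms(1) x(2) by simp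
qed

lemma newton_slope_lifts:
  assumes "point_over v fs z ws" "length ws < length fs"
    and "w \<in> neg_slopes (newton_polygon v (specialize (fs ! length ws) z))"
  shows "\<exists>z. point_over v fs z (ws @ [w])"
  using assms specialize_splits[OF assms(1,2)] root_of_newton_slope point_over_append by metis

text \<open>An expected slope lifts over every root above \<open>ws\<close>, so the root from the
  invariant serves although the algorithm has computed none.\<close>

lemma expected_slope_lifts:
  assumes "point_over v fs z ws" "length ws < length fs"
    and "unique_newton_polygon v psi res ws (fs ! length ws)"
    and "w \<in> neg_slopes (expected_newton_polygon v ws (fs ! length ws))"
  shows "\<exists>z. point_over v fs z (ws @ [w])"
proof -
  have "map v z = map ereal ws" using assms(1) by simp
  then show ?thesis
    using specialize_splits[OF assms(1,2)] root_of_expected_slope[OF _ _ _ assms(3,4)]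
      point_over_append[OF assms(1,2)] by metis
qed

text \<open>The nonzero constant and leading coefficients give two graph points, at abscissa 0 and
  at the positive degree.\<close>

lemma newton_slope_exists:
  assumes "point_over v fs z ws" "length ws < length fs"
  shows "neg_slopes (newton_polygon v (specialize (fs ! length ws) z)) \<noteq> {}"
  unfolding newton_polygon_eq_upper_hull
  using specialize_coeffs[OF assms] finite_coeff_nonzero
  by (intro neg_slopes_upper_hull_nonempty[of _ 0 "degree (specialize (fs ! length ws) z)"]) auto

lemma expected_slope_exists:
  assumes "point_over v fs z ws" "length ws < length fs"
  shows "neg_slopes (expected_newton_polygon v ws (fs ! length ws)) \<noteq> {}"
proof -
  let ?p = "specialize (fs ! length ws) z"
  \<comment> \<open>A coefficient polynomial that does not vanish at \<open>z\<close> is nonzero, so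
    the indices 0 and \<open>degree ?p\<close> also occur in the expected polygon.\<close>
  have "coeff_wrt (length ws) (fs ! length ws) i \<noteq> 0" if "coeff ?p i \<noteq> 0" for i
    using that coeff_specialize[of "fs ! length ws" z i] point_over_length[OF assms(1)] by auto
  moreover have "coeff ?p (degree ?p) \<noteq> 0" using specialize_coeffs[OF assms] by auto
  ultimately show ?thesis
    unfolding expected_newton_polygon_eq_upper_hull
    using specialize_coeffs[OF assms] finite_coeff_wrt_nonzero
    by (intro neg_slopes_upper_hull_nonempty[of _ 0 "degree ?p"]) auto
qed

section \<open>Preservation of the invariant, termination, progress and correctness\<close>

lemma point_over_Nil: "point_over v fs [] []"
  by (simp add: variety_def)

lemma alg_invariant_step:
  assumes "alg_step v psi res fs s s'" "alg_invariant v fs s"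
  shows "alg_invariant v fs s'"
  using assms
proof (cases rule: alg_step.cases)
  case (pick_first w)
  \<comment> \<open>The first pick is the general Newton slope step over the empty tuple.\<close>
  then have "\<exists>z. point_over v fs z ([] @ [w])"
    using nonempty by (intro newton_slope_lifts[OF point_over_Nil]) auto
  then show ?thesis using pick_first nonempty by (cases fs) auto
next
  case (pick_expected ws w)
  then obtain z where "point_over v fs z ws" using assms(2) by auto
  from expected_slope_lifts[OF this] show ?thesis using pick_expected by auto
next
  case (compute_root ws z)
  then show ?thesis by auto
next
  case (pick_root w ws z)
  then have "point_over v fs z ws" "length ws < length fs" using assms(2) by auto
  from newton_slope_lifts[OF this] show ?thesis using pick_root \<open>length ws < length fs\<close> by auto
next
  case (return ws)
  then show ?thesis using assms(2) by auto
qed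

lemma alg_invariant_reachable: "(alg_step v psi res fs)\<^sup>*\<^sup>* Init s \<Longrightarrow> alg_invariant v fs s"
  by (induction rule: rtranclp_induct) (auto intro: alg_invariant_step)

lemma no_infinite_run: "\<nexists>s. s 0 = Init \<and> (\<forall>i. alg_step v psi res fs (s i) (s (Suc i)))"
proof
  assume "\<exists>s. s 0 = Init \<and> (\<forall>i. alg_step v psi res fs (s i) (s (Suc i)))"
  then obtain s where s: "s 0 = Init" "\<And>i. alg_step v psi res fs (s i) (s (Suc i))" by blast
  have inv: "alg_invariant v fs (s i)" for i
    by (induction i) (auto simp: s(1) intro: alg_invariant_step[OF s(2)])
  have "i \<le> alg_rank (length fs) (s i)" for i
  proof (induction i)
    case (Suc i)
    then show ?case using alg_rank_increases[OF s(2)[of i]] by simp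
  qed simp
  \<comment> \<open>One more than the largest rank that the invariant permits.\<close>
  from this[of "2 * length fs + 3"] show False using alg_rank_le[OF inv[of "2 * length fs + 3"]] by simp
qed

lemma alg_progress:
  assumes "alg_invariant v fs s"
  shows "(\<exists>w. s = Returned w) \<or> (\<exists>s'. alg_step v psi res fs s s')"
proof (cases s)
  case Init
  have "neg_slopes (newton_polygon v (specialize (fs ! 0) [])) \<noteq> {}"
    using newton_slope_exists[OF point_over_Nil] nonempty by simp
  then show ?thesis using alg_step.pick_first Init by blast
next
  case (Looping ws)
  then obtain z where z: "point_over v fs z ws" "length ws \<le> length fs" using assms by auto
  show ?thesis
  proof (cases "length ws = length fs")
    case True
    then show ?thesis using alg_step.return Looping by blast
  next
    case False
    then have less: "length ws < length fs" using z by simp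
    show ?thesis
    proof (cases "unique_newton_polygon v psi res ws (fs ! length ws)")
      case True
      then show ?thesis
        using expected_slope_exists[OF z(1) less] alg_step.pick_expected[OF less] Looping by blast
    next
      case False
      \<comment> \<open>The root that the invariant provides lies over \<open>ws\<close>, as
        \<open>compute_root\<close> demands.\<close>
      then show ?thesis
        using z(1) alg_step.compute_root[OF less] Looping unfolding point_over.simps by blast
    qed
  qed
next
  case (Rooted ws z)
  then have "neg_slopes (newton_polygon v (specialize (fs ! length ws) z)) \<noteq> {}"
    using newton_slope_exists assms by auto
  then show ?thesis using alg_step.pick_root Rooted by blast
qed simp

lemma alg_correct:
  assumes "alg_invariant v fs (Returned w)"
  shows "w \<in> Trop v psi res (length fs) (ideal_gen (length fs) (set fs))"
  using assms Trop_of_variety by auto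

end

theorem mainTheorem2:
  fixes v :: "'a::alg_closed_field \<Rightarrow> ereal"
    and psi :: "real \<Rightarrow> 'a"
    and res :: "'a \<Rightarrow> 'k::field"
    and n :: nat
    and fs :: "'a mpoly list"
  assumes "is_valuation v"
    and "nontrivial_valuation v"
    and "1 \<in> value_group v"
    and "is_splitting v psi"
    and "is_residue_map v res"
    and "n \<ge> 1"
    and "length fs = n"
    and "triangular fs"
    and "\<forall>z\<in>variety n (set fs). \<forall>j<n. z ! j \<noteq> 0"
  shows
    \<comment> \<open>termination: there is no infinite run\<close>
    "(\<nexists>s. s 0 = Init \<and> (\<forall>i. alg_step v psi res fs (s i) (s (Suc i)))) \<and>
    \<comment> \<open>no run gets stuck: every choice that has to be made before returning is possible\<close>
     (\<forall>s. (alg_step v psi res fs)\<^sup>*\<^sup>* Init s \<longrightarrow>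
        (\<exists>w. s = Returned w) \<or> (\<exists>s'. alg_step v psi res fs s s')) \<and>
    \<comment> \<open>correctness of the output\<close>
     (\<forall>w. (alg_step v psi res fs)\<^sup>*\<^sup>* Init (Returned w) \<longrightarrow>
        w \<in> Trop v psi res n (ideal_gen n (set fs)))"
proof -
  interpret tropical_point_algorithm v psi res fs
    using assms by unfold_locales auto
  show ?thesis
    using no_infinite_run alg_progress[OF alg_invariant_reachable]
      alg_correct[OF alg_invariant_reachable] assms(7) by blast
qed

end
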